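(* Every $n$-person conditional game has a Nash equilibrium point. That is: let $n\in\mathbb N$; for each $i=1,\dots,n$ let $(E_i,\|\cdot\|_i)$ be an $RN$ module over $\mathbb K$ with base $(\Omega,\mathcal F,P)$, let $\{\pi_{i\alpha}:\alpha=1,\dots,n_i\}$ be an $L^0$-affinely independent subset of $E_i$, let $S_i=Conv_{L^0}(\{\pi_{i\alpha}:\alpha=1,\dots,n_i\})$ be the corresponding $(n_i-1)$-dimensional $L^0$-simplex, and let $p_i:S=\prod_{j=1}^nS_j\to L^0(\mathcal F)$ be an $n$-fold $L^0$-affine function. Then there exists $s=(s_1,\dots,s_n)\in S$ such that $$p_i(s_1,\dots,s_n)\ge p_i(s_1,\dots,s_{i-1},t_i,s_{i+1},\dots,s_n)$$ for each $i=1,\dots,n$ and each $t_i\in S_i$.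
   Context: Notation. $(\Omega,\mathcal F,P)$ is a probability space, $\mathbb K$ is $\mathbb R$ or $\mathbb C$. $L^0(\mathcal F,\mathbb K)$ is the algebra of a.s.-equivalence classes of $\mathbb K$-valued $\mathcal F$-measurable random variables; $L^0(\mathcal F)=L^0(\mathcal F,\mathbb R)$, partially ordered by $\xi\le\eta$ iff $\xi(\omega)\le\eta(\omega)$ a.s. $L^0_+(\mathcal F)=\{\xi\in L^0(\mathcal F):\xi\ge 0\}$; $L^0(\mathcal F,[0,1])$ is the set of equivalence classes of $[0,1]$-valued random variables. $RN$ module. An $RN$ module $(E,\|\cdot\|)$ over $\mathbb K$ with base $(\Omega,\mathcal F,P)$ is a left module $E$ over the algebra $L^0(\mathcal F,\mathbb K)$ with a map $\|\cdot\|:E\to L^0_+(\mathcal F)$ such that $\|\xi x\|=|\xi|\,\|x\|$ for all $\xi\in L^0(\mathcal F,\mathbb K)$, $x\in E$; $\|x+y\|\le\|x\|+\|y\|$ for all $x,y\in E$; and $\|x\|=0$ implies $x=\theta$ (the null element). $L^0$-simplexes. For a nonempty $G\subset E$, $Conv_{L^0}(G)=\{\sum_{i=1}^m\xi_ix_i:m\in\mathbb N,\ x_i\in G,\ \xi_i\in L^0_+(\mathcal F),\ \sum_{i=1}^m\xi_i=1\}$. A finite set $\{x_1,\dots,x_m\}\subset E$ is $L^0$-independent if $\sum_{i=1}^m\xi_ix_i=0$ with $\xi_i\in L^0(\mathcal F,\mathbb K)$ implies $\xi_i=0$ for all $i$. It is $L^0$-affinely independent if either $m=1$, or $m>1$ and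 $\{x_i-x_1:i=2,\dots,m\}$ is $L^0$-independent; in that case $Conv_{L^0}(\{x_1,\dots,x_m\})$ is called an $(m-1)$-dimensional $L^0$-simplex. $L^0$-affine functions. A nonempty $G\subset E$ is $L^0$-convex if $\xi x+(1-\xi)y\in G$ for all $x,y\in G$ and $\xi\in L^0(\mathcal F,[0,1])$. For $L^0$-convex $G$, $f:G\to L^0(\mathcal F)$ is $L^0$-affine if $f(\lambda g_1+(1-\lambda)g_2)=\lambda f(g_1)+(1-\lambda)f(g_2)$ for all $\lambda\in L^0(\mathcal F,[0,1])$, $g_1,g_2\in G$. For $L^0$-convex sets $G_i\subset E_i$, $f:\prod_{i=1}^nG_i\to L^0(\mathcal F)$ is $n$-fold $L^0$-affine if for each $i$ and each fixed $x=(x_1,\dots,x_n)\in\prod_jG_j$ the function $y_i\mapsto f(x_1,\dots,x_{i-1},y_i,x_{i+1},\dots,x_n)$ is $L^0$-affine on $G_i$. $n$-person conditional game. It consists of the data in the claim: $S_i$ is the set of mixed strategies of player $i$, the $\pi_{i\alpha}$ are the pure strategies, and $p_i$ is the $L^0$-payoff function of player $i$. A point $s\in S$ satisfying the displayed inequalities is called a Nash equilibrium point. *)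

theory Defs
  imports "HOL-Probability.Probability" "HOL-Algebra.Module"
begin

section \<open>The scalar field\<close>

text \<open>
  The class axiom says that the type is the real line or is obtained from it by adjoining a
  square root of \<open>-1\<close>. Since the norm of a \<open>real_normed_field\<close> is multiplicative, up to
  isometric isomorphism there are exactly two instances, \<^typ>\<open>real\<close> and \<^typ>\<open>complex\<close>.
\<close>

class real_or_complex = real_normed_field + second_countable_topology +
  assumes real_or_complex:
    "(\<forall>z. \<exists>a. z = a *\<^sub>R 1) \<or>
     (\<exists>\<iota>. \<iota> * \<iota> = - 1 \<and> (\<forall>z. \<exists>a b. z = a *\<^sub>R 1 + b *\<^sub>R \<iota>))"

instance real :: real_or_complex
proof
  have "\<forall>z::real. \<exists>a. z = a *\<^sub>R 1" by simp
  then show "(\<forall>z::real. \<exists>a. z = a *\<^sub>R 1) \<or>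
     (\<exists>\<iota>::real. \<iota> * \<iota> = - 1 \<and> (\<forall>z. \<exists>a b. z = a *\<^sub>R 1 + b *\<^sub>R \<iota>))" ..
qed

instance complex :: real_or_complex
proof
  have "\<exists>a b. z = a *\<^sub>R 1 + b *\<^sub>R \<i>" for z :: complex
    by (intro exI[of _ "Re z"] exI[of _ "Im z"]) (simp add: complex_eq_iff)
  then have "\<i> * \<i> = - 1 \<and> (\<forall>z. \<exists>a b. z = a *\<^sub>R 1 + b *\<^sub>R \<i>)"
    by simp
  then show "(\<forall>z::complex. \<exists>a. z = a *\<^sub>R 1) \<or>
     (\<exists>\<iota>::complex. \<iota> * \<iota> = - 1 \<and> (\<forall>z. \<exists>a b. z = a *\<^sub>R 1 + b *\<^sub>R \<iota>))" by blast
qed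


section \<open>The ring of classes of random variables\<close>

text \<open>
  The type of values plays the role of \<open>\<bbbK>\<close>; in particular \<open>L\<^sup>0(\<F>)\<close> is the ring of classes
  of real-valued functions. Functions are total on \<^typ>\<open>'a\<close>, but their values outside
  \<^term>\<open>space M\<close> are irrelevant to the relation below.
\<close>

definition ae_rel :: "'a measure \<Rightarrow> (('a \<Rightarrow> 'b::topological_space) \<times> ('a \<Rightarrow> 'b)) set" where
  "ae_rel M = {(f, g). f \<in> borel_measurable M \<and> g \<in> borel_measurable M \<and>
                       (AE \<omega> in M. f \<omega> = g \<omega>)}"

definition ae_class :: "'a measure \<Rightarrow> ('a \<Rightarrow> 'b::topological_space) \<Rightarrow> ('a \<Rightarrow> 'b) set" where
  "ae_class M f = ae_rel M `` {f}"

definition l0_map ::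
  "'a measure \<Rightarrow> ('b \<Rightarrow> 'c) \<Rightarrow> ('a \<Rightarrow> 'b::topological_space) set
     \<Rightarrow> ('a \<Rightarrow> 'c::topological_space) set" where
  "l0_map M \<phi> X = (\<Union>f\<in>X. ae_class M (\<lambda>\<omega>. \<phi> (f \<omega>)))"

definition l0_map2 ::
  "'a measure \<Rightarrow> ('b \<Rightarrow> 'b \<Rightarrow> 'b) \<Rightarrow> ('a \<Rightarrow> 'b::topological_space) set \<Rightarrow> ('a \<Rightarrow> 'b) set
     \<Rightarrow> ('a \<Rightarrow> 'b) set" where
  "l0_map2 M \<phi> X Y = (\<Union>f\<in>X. \<Union>g\<in>Y. ae_class M (\<lambda>\<omega>. \<phi> (f \<omega>) (g \<omega>)))"

definition L0 :: "'a measure \<Rightarrow> ('a \<Rightarrow> 'k::real_or_complex) set ring" where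
  "L0 M = \<lparr>carrier = borel_measurable M // ae_rel M,
           mult = l0_map2 M (*), one = ae_class M (\<lambda>_. 1),
           zero = ae_class M (\<lambda>_. 0), add = l0_map2 M (+)\<rparr>"

definition l0_le :: "'a measure \<Rightarrow> ('a \<Rightarrow> real) set \<Rightarrow> ('a \<Rightarrow> real) set \<Rightarrow> bool" where
  "l0_le M X Y \<longleftrightarrow> (\<exists>f\<in>X. \<exists>g\<in>Y. AE \<omega> in M. f \<omega> \<le> g \<omega>)"

definition L0_nonneg :: "'a measure \<Rightarrow> ('a \<Rightarrow> real) set set" where
  "L0_nonneg M = {X \<in> carrier (L0 M). l0_le M \<zero>\<^bsub>L0 M\<^esub> X}"

definition L0_unit_interval :: "'a measure \<Rightarrow> ('a \<Rightarrow> real) set set" where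
  "L0_unit_interval M =
     {ae_class M f | f. f \<in> borel_measurable M \<and> (\<forall>\<omega>\<in>space M. f \<omega> \<in> {0..1})}"

definition l0_abs :: "'a measure \<Rightarrow> ('a \<Rightarrow> 'k::real_or_complex) set \<Rightarrow> ('a \<Rightarrow> real) set" where
  "l0_abs M = l0_map M norm"

text \<open>The inclusion of \<open>L\<^sup>0(\<F>)\<close> into \<open>L\<^sup>0(\<F>, \<bbbK>)\<close>.\<close>

definition l0_of_real :: "'a measure \<Rightarrow> ('a \<Rightarrow> real) set \<Rightarrow> ('a \<Rightarrow> 'k::real_or_complex) set" where
  "l0_of_real M = l0_map M of_real"

lemma equiv_ae_rel: "equiv (borel_measurable M) (ae_rel M)"
proof (rule equivI)
  show "ae_rel M \<subseteq> borel_measurable M \<times> borel_measurable M"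
    by (auto simp: ae_rel_def)
  show "refl_on (borel_measurable M) (ae_rel M)"
    by (auto simp: refl_on_def ae_rel_def)
  show "sym (ae_rel M)"
    by (auto simp: sym_def ae_rel_def eq_commute)
  show "trans (ae_rel M)"
  proof (rule transI)
    fix f g h assume "(f, g) \<in> ae_rel M" "(g, h) \<in> ae_rel M"
    then have "f \<in> borel_measurable M" "h \<in> borel_measurable M"
      "AE \<omega> in M. f \<omega> = g \<omega>" "AE \<omega> in M. g \<omega> = h \<omega>"
      by (auto simp: ae_rel_def)
    moreover from this have "AE \<omega> in M. f \<omega> = h \<omega>" by auto
    ultimately show "(f, h) \<in> ae_rel M" by (simp add: ae_rel_def)
  qed
qed

lemma ae_class_eq_iff:
  assumes "f \<in> borel_measurable M" "g \<in> borel_measurable M"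
  shows "ae_class M f = ae_class M g \<longleftrightarrow> (AE \<omega> in M. f \<omega> = g \<omega>)"
  using eq_equiv_class_iff[OF equiv_ae_rel assms] assms
  by (simp add: ae_class_def ae_rel_def)

lemma in_ae_class_iff:
  "g \<in> ae_class M f \<longleftrightarrow>
     f \<in> borel_measurable M \<and> g \<in> borel_measurable M \<and> (AE \<omega> in M. f \<omega> = g \<omega>)"
  by (simp add: ae_class_def ae_rel_def)

lemma carrier_L0:
  "carrier (L0 M :: ('a \<Rightarrow> 'k::real_or_complex) set ring) = ae_class M ` borel_measurable M"
  by (auto simp: L0_def quotient_def ae_class_def)

lemma l0_map_class:
  assumes f: "f \<in> borel_measurable M" and \<phi>: "\<phi> \<in> borel_measurable borel"
  shows "l0_map M \<phi> (ae_class M f) = ae_class M (\<lambda>\<omega>. \<phi> (f \<omega>))"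
proof -
  have "ae_class M (\<lambda>\<omega>. \<phi> (f' \<omega>)) = ae_class M (\<lambda>\<omega>. \<phi> (f \<omega>))" if "f' \<in> ae_class M f" for f'
  proof -
    from that have "f' \<in> borel_measurable M" and ae: "AE \<omega> in M. f \<omega> = f' \<omega>"
      by (auto simp: in_ae_class_iff)
    moreover from ae have "AE \<omega> in M. \<phi> (f' \<omega>) = \<phi> (f \<omega>)" by eventually_elim simp
    ultimately show ?thesis
      using f measurable_compose[OF _ \<phi>] by (subst ae_class_eq_iff) auto
  qed
  moreover have "f \<in> ae_class M f" using f by (simp add: in_ae_class_iff)
  ultimately show ?thesis unfolding l0_map_def by blast
qed

lemma l0_map2_class:
  assumes f: "f \<in> borel_measurable M" and g: "g \<in> borel_measurable M"
    and \<phi>: "\<And>f g. f \<in> borel_measurable M \<Longrightarrow> g \<in> borel_measurable M \<Longrightarrow>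
              (\<lambda>\<omega>. \<phi> (f \<omega>) (g \<omega>)) \<in> borel_measurable M"
  shows "l0_map2 M \<phi> (ae_class M f) (ae_class M g) = ae_class M (\<lambda>\<omega>. \<phi> (f \<omega>) (g \<omega>))"
proof -
  have "ae_class M (\<lambda>\<omega>. \<phi> (f' \<omega>) (g' \<omega>)) = ae_class M (\<lambda>\<omega>. \<phi> (f \<omega>) (g \<omega>))"
    if "f' \<in> ae_class M f" "g' \<in> ae_class M g" for f' g'
  proof -
    from that have "f' \<in> borel_measurable M" "g' \<in> borel_measurable M"
      and ae: "AE \<omega> in M. f \<omega> = f' \<omega>" "AE \<omega> in M. g \<omega> = g' \<omega>"
      by (auto simp: in_ae_class_iff)
    moreover from ae have "AE \<omega> in M. \<phi> (f' \<omega>) (g' \<omega>) = \<phi> (f \<omega>) (g \<omega>)"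
      by eventually_elim simp
    ultimately show ?thesis
      using f g \<phi> by (subst ae_class_eq_iff) auto
  qed
  moreover have "f \<in> ae_class M f" "g \<in> ae_class M g" using f g by (simp_all add: in_ae_class_iff)
  ultimately show ?thesis unfolding l0_map2_def by blast
qed

lemma L0_mult_class:
  fixes f g :: "'a \<Rightarrow> 'k::real_or_complex"
  assumes "f \<in> borel_measurable M" "g \<in> borel_measurable M"
  shows "ae_class M f \<otimes>\<^bsub>L0 M\<^esub> ae_class M g = ae_class M (\<lambda>\<omega>. f \<omega> * g \<omega>)"
  by (simp add: L0_def l0_map2_class assms)

lemma L0_add_class:
  fixes f g :: "'a \<Rightarrow> 'k::real_or_complex"
  assumes "f \<in> borel_measurable M" "g \<in> borel_measurable M"
  shows "ae_class M f \<oplus>\<^bsub>L0 M\<^esub> ae_class M g = ae_class M (\<lambda>\<omega>. f \<omega> + g \<omega>)"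
  by (simp add: L0_def l0_map2_class assms)

lemma L0_one: "\<one>\<^bsub>L0 M\<^esub> = ae_class M (\<lambda>_. 1)"
  and L0_zero: "\<zero>\<^bsub>L0 M\<^esub> = ae_class M (\<lambda>_. 0)"
  by (simp_all add: L0_def)

lemma cring_L0: "cring (L0 M :: ('a \<Rightarrow> 'k::real_or_complex) set ring)"
proof (rule cringI)
  show "abelian_group (L0 M :: ('a \<Rightarrow> 'k) set ring)"
  proof (rule abelian_groupI)
    fix X :: "('a \<Rightarrow> 'k) set" assume "X \<in> carrier (L0 M)"
    then obtain f where f: "f \<in> borel_measurable M" "X = ae_class M f"
      by (auto simp: carrier_L0)
    then have "ae_class M (\<lambda>\<omega>. - f \<omega>) \<in> carrier (L0 M)"
      "ae_class M (\<lambda>\<omega>. - f \<omega>) \<oplus>\<^bsub>L0 M\<^esub> X = \<zero>\<^bsub>L0 M\<^esub>"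
      by (auto simp: carrier_L0 L0_add_class L0_zero)
    then show "\<exists>Y\<in>carrier (L0 M). Y \<oplus>\<^bsub>L0 M\<^esub> X = \<zero>\<^bsub>L0 M\<^esub>" by blast
  qed (auto simp: carrier_L0 L0_add_class L0_zero add_ac)
  show "comm_monoid (L0 M :: ('a \<Rightarrow> 'k) set ring)"
    by (rule comm_monoidI) (auto simp: carrier_L0 L0_mult_class L0_one mult_ac)
qed (auto simp: carrier_L0 L0_mult_class L0_add_class distrib_right)


section \<open>Random normed modules\<close>

locale rn_module = prob_space M + module "L0 M" E
  for M :: "'a measure"
    and E :: "(('a \<Rightarrow> 'k::real_or_complex) set, 'e) module" (structure) +
  fixes rnorm :: "'e \<Rightarrow> ('a \<Rightarrow> real) set"
  assumes rnorm_nonneg: "x \<in> carrier E \<Longrightarrow> rnorm x \<in> L0_nonneg M"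
    and rnorm_smult: "\<xi> \<in> carrier (L0 M) \<Longrightarrow> x \<in> carrier E \<Longrightarrow>
          rnorm (\<xi> \<odot>\<^bsub>E\<^esub> x) = l0_abs M \<xi> \<otimes>\<^bsub>L0 M\<^esub> rnorm x"
    and rnorm_triangle: "x \<in> carrier E \<Longrightarrow> y \<in> carrier E \<Longrightarrow>
          l0_le M (rnorm (x \<oplus>\<^bsub>E\<^esub> y)) (rnorm x \<oplus>\<^bsub>L0 M\<^esub> rnorm y)"
    and rnorm_eq_zero: "x \<in> carrier E \<Longrightarrow> rnorm x = \<zero>\<^bsub>L0 M\<^esub> \<Longrightarrow> x = \<zero>\<^bsub>E\<^esub>"


section \<open>Simplexes and affine functions\<close>

definition l0_conv ::
  "'a measure \<Rightarrow> (('a \<Rightarrow> 'k::real_or_complex) set, 'e) module \<Rightarrow> 'e set \<Rightarrow> 'e set" where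
  "l0_conv M E G =
     {(\<Oplus>\<^bsub>E\<^esub>i\<in>{1..m}. l0_of_real M (\<xi> i) \<odot>\<^bsub>E\<^esub> x i) | (m::nat) \<xi> x.
        1 \<le> m \<and> x \<in> {1..m} \<rightarrow> G \<and> \<xi> \<in> {1..m} \<rightarrow> L0_nonneg M \<and>
        (\<Oplus>\<^bsub>L0 M\<^esub>i\<in>{1..m}. \<xi> i) = \<one>\<^bsub>L0 M\<^esub>}"

text \<open>
  Independence is stated for families, so that it includes the distinctness of the listed
  points that is implicit in writing them as a set with \<open>m\<close> elements.
\<close>

definition l0_independent ::
  "'a measure \<Rightarrow> (('a \<Rightarrow> 'k::real_or_complex) set, 'e) module \<Rightarrow> 'i set \<Rightarrow> ('i \<Rightarrow> 'e) \<Rightarrow> bool" where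
  "l0_independent M E I x \<longleftrightarrow>
     (\<forall>\<xi>. \<xi> \<in> I \<rightarrow> carrier (L0 M) \<longrightarrow> (\<Oplus>\<^bsub>E\<^esub>i\<in>I. \<xi> i \<odot>\<^bsub>E\<^esub> x i) = \<zero>\<^bsub>E\<^esub> \<longrightarrow>
          (\<forall>i\<in>I. \<xi> i = \<zero>\<^bsub>L0 M\<^esub>))"

definition l0_affinely_independent ::
  "'a measure \<Rightarrow> (('a \<Rightarrow> 'k::real_or_complex) set, 'e) module \<Rightarrow> nat \<Rightarrow> (nat \<Rightarrow> 'e) \<Rightarrow> bool" where
  "l0_affinely_independent M E m x \<longleftrightarrow>
     m = 1 \<or> m > 1 \<and> l0_independent M E {2..m} (\<lambda>i. x i \<ominus>\<^bsub>E\<^esub> x 1)"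

definition l0_combination ::
  "'a measure \<Rightarrow> (('a \<Rightarrow> 'k::real_or_complex) set, 'e) module
     \<Rightarrow> ('a \<Rightarrow> real) set \<Rightarrow> 'e \<Rightarrow> 'e \<Rightarrow> 'e" where
  "l0_combination M E \<xi> x y =
     l0_of_real M \<xi> \<odot>\<^bsub>E\<^esub> x \<oplus>\<^bsub>E\<^esub> l0_of_real M (\<one>\<^bsub>L0 M\<^esub> \<ominus>\<^bsub>L0 M\<^esub> \<xi>) \<odot>\<^bsub>E\<^esub> y"

text \<open>
  To be used for \<open>L\<^sup>0\<close>-convex \<open>G\<close>, that is, when \<open>G\<close> contains all the combinations below;
  every set of the form \<^term>\<open>l0_conv M E G\<close> with \<^term>\<open>G \<subseteq> carrier E\<close> has this property.
\<close>

definition l0_affine_on ::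
  "'a measure \<Rightarrow> (('a \<Rightarrow> 'k::real_or_complex) set, 'e) module \<Rightarrow> 'e set
     \<Rightarrow> ('e \<Rightarrow> ('a \<Rightarrow> real) set) \<Rightarrow> bool" where
  "l0_affine_on M E G f \<longleftrightarrow>
     f \<in> G \<rightarrow> carrier (L0 M) \<and>
     (\<forall>\<xi>\<in>L0_unit_interval M. \<forall>x\<in>G. \<forall>y\<in>G.
        f (l0_combination M E \<xi> x y) =
          \<xi> \<otimes>\<^bsub>L0 M\<^esub> f x \<oplus>\<^bsub>L0 M\<^esub> (\<one>\<^bsub>L0 M\<^esub> \<ominus>\<^bsub>L0 M\<^esub> \<xi>) \<otimes>\<^bsub>L0 M\<^esub> f y)"

definition multi_l0_affine_on ::
  "'a measure \<Rightarrow> nat \<Rightarrow> (nat \<Rightarrow> (('a \<Rightarrow> 'k::real_or_complex) set, 'e) module) \<Rightarrow> (nat \<Rightarrow> 'e set)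
     \<Rightarrow> ((nat \<Rightarrow> 'e) \<Rightarrow> ('a \<Rightarrow> real) set) \<Rightarrow> bool" where
  "multi_l0_affine_on M n E G f \<longleftrightarrow>
     f \<in> (\<Pi>\<^sub>E i\<in>{1..n}. G i) \<rightarrow> carrier (L0 M) \<and>
     (\<forall>i\<in>{1..n}. \<forall>x\<in>(\<Pi>\<^sub>E j\<in>{1..n}. G j). l0_affine_on M (E i) (G i) (\<lambda>y. f (x(i := y))))"

end

theory Submission
  imports Defs
begin

text \<open>
  Since the payoff functions are \<open>n\<close>-fold \<open>L\<^sup>0\<close>-affine, representatives of their values at the
  profiles of vertices define an ordinary finite game for every \<open>\<omega>\<close>, and the payoff of a profile
  with given barycentric coordinates is represented by the mixed payoff of these games, evaluated
  pointwise. Each of these games has a Nash equilibrium by Brouwer's theorem. The equilibria are the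
  zeros of a regret function that is measurable in \<open>\<omega>\<close> and continuous in the profile, so that an
  equilibrium can be chosen measurably in \<open>\<omega>\<close>, as the lexicographically least one. Its coordinates
  are the barycentric coordinates of an equilibrium of the conditional game.
\<close>

section \<open>Brouwer's theorem for a cube with finitely many coordinates\<close>

text \<open>The number of pure strategies is part of the data, so no fixed Euclidean space can hold
  the profiles. They are functions on index pairs that vanish off a finite set, under the product
  topology, and Brouwer's theorem is derived for such functions from Kuhn's combinatorial lemma. The
  obstacle is measurability: equilibria need not be unique, so choosing one separately for each
  \<open>\<omega>\<close> need not give random variables. Two reductions make a selection possible.
  The payoff is linear in each player's weights, so it suffices to test finitely many pure
  deviations, and the sum of the positive parts of their gains turns all the inequalities into one
  equation. The set of mixed profiles does not depend on \<open>\<omega>\<close>, so only the zero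
  set of this equation is random, inside a fixed compact set. Null sets are confined to the passage
  between classes and representatives: once representatives are fixed, the games, weights and
  inequalities are treated at every point of \<open>space M\<close>.\<close>

definition coord_cube :: "'i set \<Rightarrow> ('i \<Rightarrow> real) set" where
  "coord_cube I = {x. (\<forall>i\<in>I. 0 \<le> x i \<and> x i \<le> 1) \<and> (\<forall>i. i \<notin> I \<longrightarrow> x i = 0)}"

lemma tendsto_fun_iff:
  fixes f :: "'b \<Rightarrow> 'i \<Rightarrow> 'c::topological_space"
  shows "(f \<longlongrightarrow> l) F \<longleftrightarrow> (\<forall>i. ((\<lambda>x. f x i) \<longlongrightarrow> l i) F)"
  using limitin_componentwise[of "\<lambda>_. euclidean" UNIV f l F]
  by (simp add: euclidean_product_topology)

text \<open>Tychonoff's theorem: prescribing the value \<open>0\<close> off \<open>I\<close> makes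
  the cube a product over the whole index type, with the compact factor \<open>{0}\<close>
  there.\<close>

lemma compact_coord_cube: "compact (coord_cube I)"
proof -
  let ?B = "\<lambda>i. if i \<in> I then {0..1::real} else {0}"
  have "x i \<in> ?B i \<longleftrightarrow> (i \<in> I \<longrightarrow> 0 \<le> x i \<and> x i \<le> 1) \<and> (i \<notin> I \<longrightarrow> x i = 0)" for x i
    by auto
  then have "coord_cube I = PiE UNIV ?B"
    unfolding coord_cube_def PiE_UNIV_domain by blast
  moreover have "\<forall>i\<in>UNIV. compactin euclidean (?B i)"
    by simp
  then have "compactin (product_topology (\<lambda>_. euclidean) UNIV) (PiE UNIV ?B)"
    unfolding compactin_PiE by (rule disjI2)
  ultimately show ?thesis
    by (simp only: euclidean_product_topology compactin_euclidean_iff)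
qed

text \<open>
  A cell of the grid of mesh \<open>1/p\<close> in which, for every coordinate, the displacement \<open>f u - u\<close>
  takes both signs (weakly).
\<close>

lemma kuhn_grid_point:
  fixes f :: "('i \<Rightarrow> real) \<Rightarrow> 'i \<Rightarrow> real"
  assumes "finite I" and f: "f ` coord_cube I \<subseteq> coord_cube I" and p: "0 < (p::nat)"
  shows "\<exists>w. w \<in> coord_cube I \<and> (\<forall>i\<in>I. \<exists>u\<in>coord_cube I. \<exists>v\<in>coord_cube I.
           (\<forall>j. \<bar>u j - w j\<bar> \<le> 1 / p) \<and> (\<forall>j. \<bar>v j - w j\<bar> \<le> 1 / p) \<and> u i \<le> f u i \<and> f v i \<le> v i)"
proof -
  define d where "d = card I"
  obtain b where b: "bij_betw b {0..<d} I"
    using ex_bij_betw_nat_finite[OF \<open>finite I\<close>] unfolding d_def by blast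
  define e where "e = inv_into {0..<d} b"
  have be: "e i < d" "b (e i) = i" if "i \<in> I" for i
    using b that bij_betw_inv_into[OF b] by (auto simp: e_def bij_betw_inv_into_right dest: bij_betwE)
  have eb: "b k \<in> I" "e (b k) = k" if "k < d" for k
    using b that by (auto simp: e_def bij_betw_inv_into_left bij_betwE)
  \<comment> \<open>Kuhn's lemma numbers the coordinates from \<open>0\<close> to
    \<open>d - 1\<close>; \<open>G\<close> turns an integer vector into a grid point by way of the
    numbering \<open>e\<close> of \<open>I\<close>.\<close>
  define G where "G x = (\<lambda>i. if i \<in> I then real (x (e i)) / p else 0)" for x :: "nat \<Rightarrow> nat"
  have G: "G x \<in> coord_cube I" if "\<forall>k<d. x k \<le> p" for x
    using that p be by (auto simp: G_def coord_cube_def)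
  have Gb: "G x (b k) = x k / p" if "k < d" for x k
    using eb[OF that] by (simp add: G_def)
  \<comment> \<open>Label \<open>0\<close> stands for a displacement that is weakly upwards, label
    \<open>1\<close> for one that is weakly downwards. The boundary cases come first because Kuhn's
    lemma prescribes the labels on opposite faces; they respect the signs because \<open>f\<close>
    has its values between \<open>0\<close> and \<open>1\<close>.\<close>
  define label where "label x k =
      (if x k = 0 then 0 else if x k = p then 1 else if G x (b k) \<le> f (G x) (b k) then 0 else 1::nat)"
    for x k
  have label01: "label x k = 0 \<or> label x k = 1" for x k
    by (simp add: label_def)
  have lab: "label x k = 0 \<Longrightarrow> G x (b k) \<le> f (G x) (b k)"
            "label x k = 1 \<Longrightarrow> f (G x) (b k) \<le> G x (b k)"
    if "\<forall>k<d. x k \<le> p" "k < d" for x k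
  proof -
    have "f (G x) \<in> coord_cube I" using f G[OF that(1)] by blast
    then have "0 \<le> f (G x) (b k)" "f (G x) (b k) \<le> 1"
      using eb[OF that(2)] by (auto simp: coord_cube_def)
    then show "label x k = 0 \<Longrightarrow> G x (b k) \<le> f (G x) (b k)"
            "label x k = 1 \<Longrightarrow> f (G x) (b k) \<le> G x (b k)"
      using p Gb[OF that(2), of x] by (auto simp: label_def split: if_splits)
  qed
  obtain q where q: "\<forall>k<d. q k < p"
    and near: "\<forall>k<d. \<exists>r s. (\<forall>j<d. q j \<le> r j \<and> r j \<le> q j + 1) \<and>
                 (\<forall>j<d. q j \<le> s j \<and> s j \<le> q j + 1) \<and> label r k \<noteq> label s k"
  proof (rule kuhn_lemma[OF p, of d label])
    show "\<forall>x. (\<forall>i<d. x i \<le> p) \<longrightarrow> (\<forall>i<d. x i = p \<longrightarrow> label x i = 1)"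
      using p by (auto simp: label_def)
  qed (auto simp: label_def)
  have close: "\<bar>G r j - G q j\<bar> \<le> 1 / p" and grid: "\<forall>k<d. r k \<le> p"
    if "\<forall>j<d. q j \<le> r j \<and> r j \<le> q j + 1" for r j
  proof -
    show "\<forall>k<d. r k \<le> p" using that q by (metis Suc_eq_plus1 Suc_leI order_trans)
    show "\<bar>G r j - G q j\<bar> \<le> 1 / p"
    proof (cases "j \<in> I")
      case True
      then have "q (e j) \<le> r (e j)" "r (e j) \<le> q (e j) + 1" using that be by auto
      then have "\<bar>real (r (e j)) - q (e j)\<bar> \<le> 1" by linarith
      then show ?thesis using True p
        by (simp add: G_def diff_divide_distrib[symmetric] divide_right_mono)
    qed (simp add: G_def)
  qed
  show ?thesis
  proof (intro exI[of _ "G q"] conjI ballI)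
    show "G q \<in> coord_cube I" using q by (intro G) auto
    fix i assume "i \<in> I"
    with near be[of i] obtain r s where rs: "\<forall>j<d. q j \<le> r j \<and> r j \<le> q j + 1"
      "\<forall>j<d. q j \<le> s j \<and> s j \<le> q j + 1" "label r (e i) \<noteq> label s (e i)" by blast
    \<comment> \<open>Which of the two corners has label \<open>0\<close> is unknown, but only two
      labels exist, so each of them occurs.\<close>
    have "\<exists>u v. (u = r \<or> u = s) \<and> (v = r \<or> v = s) \<and> label u (e i) = 0 \<and> label v (e i) = 1"
      using rs(3) label01 by metis
    then obtain u v where uv: "\<forall>j<d. q j \<le> u j \<and> u j \<le> q j + 1"
      "\<forall>j<d. q j \<le> v j \<and> v j \<le> q j + 1" "label u (e i) = 0" "label v (e i) = 1"
      using rs by blast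
    show "\<exists>u\<in>coord_cube I. \<exists>v\<in>coord_cube I. (\<forall>j. \<bar>u j - G q j\<bar> \<le> 1 / p) \<and>
            (\<forall>j. \<bar>v j - G q j\<bar> \<le> 1 / p) \<and> u i \<le> f u i \<and> f v i \<le> v i"
    proof (rule bexI[of _ "G u"], rule bexI[of _ "G v"], intro conjI allI)
      show "\<bar>G u j - G q j\<bar> \<le> 1 / p" "\<bar>G v j - G q j\<bar> \<le> 1 / p" for j
        by (fact close[OF uv(1)] close[OF uv(2)])+
      show "G u \<in> coord_cube I" "G v \<in> coord_cube I"
        by (fact G[OF grid[OF uv(1)]] G[OF grid[OF uv(2)]])+
      show "G u i \<le> f (G u) i" "f (G v) i \<le> G v i"
        using lab(1)[OF grid[OF uv(1)] be(1) uv(3)] lab(2)[OF grid[OF uv(2)] be(1) uv(4)]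
          be(2)[OF \<open>i \<in> I\<close>] \<open>i \<in> I\<close> by simp_all
    qed
  qed
qed

text \<open>The corners \<open>w m\<close> of ever finer cells have a convergent subsequence, and
  all points of these cells collapse to its limit \<open>z\<close>. By continuity both weak signs of
  the displacement survive at \<open>z\<close>, so it vanishes. The sort \<open>countable\<close>
  makes the function space metric, hence compact sets sequentially compact.\<close>

lemma brouwer_coord_cube:
  fixes f :: "('i::countable \<Rightarrow> real) \<Rightarrow> 'i \<Rightarrow> real"
  assumes "finite I" and cont: "continuous_on (coord_cube I) f"
    and f: "f ` coord_cube I \<subseteq> coord_cube I"
  obtains z where "z \<in> coord_cube I" "f z = z"
proof -
  let ?near = "\<lambda>m u w. \<forall>j. \<bar>u j - w j\<bar> \<le> 1 / real (Suc m)"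
  have "\<forall>m. \<exists>w. w \<in> coord_cube I \<and> (\<forall>i\<in>I. \<exists>u\<in>coord_cube I. \<exists>v\<in>coord_cube I.
      ?near m u w \<and> ?near m v w \<and> u i \<le> f u i \<and> f v i \<le> v i)"
    by (rule allI) (rule kuhn_grid_point[OF \<open>finite I\<close> f zero_less_Suc])
  from choice[OF this] obtain w where ww: "\<forall>m. w m \<in> coord_cube I \<and> (\<forall>i\<in>I. \<exists>u\<in>coord_cube I.
      \<exists>v\<in>coord_cube I. ?near m u (w m) \<and> ?near m v (w m) \<and> u i \<le> f u i \<and> f v i \<le> v i)"
    by (rule exE)
  have w: "w m \<in> coord_cube I" for m
    using ww by blast
  \<comment> \<open>The witnesses depend on the coordinate \<open>i\<close>. Only \<open>w\<close>,
    and with it the subsequence \<open>\<phi>\<close> chosen below, is common to all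
    coordinates.\<close>
  have u_ex: "\<exists>u. \<forall>m. u m \<in> coord_cube I \<and> ?near m (u m) (w m) \<and> u m i \<le> f (u m) i"
    and v_ex: "\<exists>v. \<forall>m. v m \<in> coord_cube I \<and> ?near m (v m) (w m) \<and> f (v m) i \<le> v m i"
    if "i \<in> I" for i
  proof -
    have *: "\<exists>u\<in>coord_cube I. \<exists>v\<in>coord_cube I.
        ?near m u (w m) \<and> ?near m v (w m) \<and> u i \<le> f u i \<and> f v i \<le> v i" for m
      using ww that by blast
    show "\<exists>u. \<forall>m. u m \<in> coord_cube I \<and> ?near m (u m) (w m) \<and> u m i \<le> f (u m) i"
      by (rule choice, rule allI) (use * in blast)
    show "\<exists>v. \<forall>m. v m \<in> coord_cube I \<and> ?near m (v m) (w m) \<and> f (v m) i \<le> v m i"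
      by (rule choice, rule allI) (use * in blast)
  qed
  obtain z \<phi> where z: "z \<in> coord_cube I" and \<phi>: "strict_mono (\<phi> :: nat \<Rightarrow> nat)" "(w \<circ> \<phi>) \<longlonglongrightarrow> z"
    using compact_coord_cube[of I] w unfolding compact_eq_seq_compact_metric seq_compact_def by metis
  have lim: "(\<lambda>m. y (\<phi> m)) \<longlonglongrightarrow> z" if "\<And>m. ?near m (y m) (w m)" for y
  proof -
    have "(\<lambda>m. y (\<phi> m) j) \<longlonglongrightarrow> z j" for j
    proof -
      have "(\<lambda>m. w (\<phi> m) j) \<longlonglongrightarrow> z j"
        using \<phi>(2) by (simp add: tendsto_fun_iff o_def)
      moreover have "(\<lambda>m. y (\<phi> m) j - w (\<phi> m) j) \<longlonglongrightarrow> 0"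
      proof (rule Lim_null_comparison)
        show "\<forall>\<^sub>F m in sequentially. norm (y (\<phi> m) j - w (\<phi> m) j) \<le> 1 / real (Suc (\<phi> m))"
          using that by auto
        show "(\<lambda>m. 1 / real (Suc (\<phi> m))) \<longlonglongrightarrow> 0"
          using LIMSEQ_subseq_LIMSEQ[OF LIMSEQ_Suc[OF lim_1_over_n] \<phi>(1)] by (simp add: o_def)
      qed
      ultimately show ?thesis using tendsto_add by fastforce
    qed
    then show ?thesis by (simp add: tendsto_fun_iff)
  qed
  have flim: "(\<lambda>m. f (y (\<phi> m)) i) \<longlonglongrightarrow> f z i" "(\<lambda>m. y (\<phi> m) i) \<longlonglongrightarrow> z i"
    if "\<And>m. y m \<in> coord_cube I" "\<And>m. ?near m (y m) (w m)" for y i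
  proof -
    have "(\<lambda>m. f (y (\<phi> m))) \<longlonglongrightarrow> f z"
      by (rule continuous_on_tendsto_compose[OF cont lim[OF that(2)] z]) (simp add: that)
    then show "(\<lambda>m. f (y (\<phi> m)) i) \<longlonglongrightarrow> f z i" "(\<lambda>m. y (\<phi> m) i) \<longlonglongrightarrow> z i"
      using lim[OF that(2)] by (simp_all add: tendsto_fun_iff)
  qed
  have "f z i = z i" for i
  proof (cases "i \<in> I")
    case True
    from u_ex[OF True] obtain u
      where u: "\<forall>m. u m \<in> coord_cube I \<and> ?near m (u m) (w m) \<and> u m i \<le> f (u m) i" by (rule exE)
    from v_ex[OF True] obtain v
      where v: "\<forall>m. v m \<in> coord_cube I \<and> ?near m (v m) (w m) \<and> f (v m) i \<le> v m i" by (rule exE)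
    have "z i \<le> f z i"
      using u by (intro LIMSEQ_le[OF flim(2) flim(1), of u]) auto
    moreover have "f z i \<le> z i"
      using v by (intro LIMSEQ_le[OF flim(1) flim(2), of v]) auto
    ultimately show ?thesis by simp
  next
    case False
    have "f z \<in> coord_cube I" using f z by blast
    with False z show ?thesis by (simp add: coord_cube_def)
  qed
  with z show ?thesis by (intro that[of z]) auto
qed

section \<open>Equilibria of finite games\<close>

definition mixed_profiles :: "'p set \<Rightarrow> ('p \<Rightarrow> 'q set) \<Rightarrow> ('p \<times> 'q \<Rightarrow> real) set" where
  "mixed_profiles P B = {x. (\<forall>i\<in>P. (\<forall>\<alpha>\<in>B i. 0 \<le> x (i, \<alpha>)) \<and> (\<Sum>\<alpha>\<in>B i. x (i, \<alpha>)) = 1) \<and>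
     (\<forall>k. k \<notin> Sigma P B \<longrightarrow> x k = 0)}"

definition deviate :: "('p \<times> 'q \<Rightarrow> real) \<Rightarrow> 'p \<Rightarrow> ('q \<Rightarrow> real) \<Rightarrow> 'p \<times> 'q \<Rightarrow> real" where
  "deviate x i y = (\<lambda>(j, \<alpha>). if j = i then y \<alpha> else x (j, \<alpha>))"

definition pure :: "'q \<Rightarrow> 'q \<Rightarrow> real" where
  "pure \<alpha> = (\<lambda>\<beta>. if \<beta> = \<alpha> then 1 else 0)"

lemma continuous_on_coordinate: "continuous_on S (\<lambda>x. (x :: 'i \<Rightarrow> real) i)"
  by (rule continuous_on_product_then_coordinatewise[OF continuous_on_id])

lemma continuous_on_deviate: "continuous_on S (\<lambda>x. deviate x i y)"
proof (rule continuous_on_coordinatewise_then_product)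
  show "continuous_on S (\<lambda>x. deviate x i y k)" for k
    by (cases k; cases "fst k = i") (simp_all add: deviate_def continuous_on_coordinate)
qed

lemma mixed_profiles_subset_coord_cube:
  assumes "\<And>i. i \<in> P \<Longrightarrow> finite (B i)"
  shows "mixed_profiles P B \<subseteq> coord_cube (Sigma P B)"
proof
  fix x assume x: "x \<in> mixed_profiles P B"
  have "x (i, \<alpha>) \<le> 1" if "i \<in> P" "\<alpha> \<in> B i" for i \<alpha>
    using member_le_sum[of \<alpha> "B i" "\<lambda>\<alpha>. x (i, \<alpha>)"] x that assms by (auto simp: mixed_profiles_def)
  then show "x \<in> coord_cube (Sigma P B)"
    using x by (auto simp: mixed_profiles_def coord_cube_def)
qed

lemma compact_mixed_profiles:
  fixes B :: "'p::countable \<Rightarrow> 'q::countable set"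
  assumes fin: "\<And>i. i \<in> P \<Longrightarrow> finite (B i)"
  shows "compact (mixed_profiles P B)"
proof -
  have eq: "mixed_profiles P B = coord_cube (Sigma P B) \<inter> (\<Inter>i\<in>P. {x. (\<Sum>\<alpha>\<in>B i. x (i, \<alpha>)) = 1})"
    (is "_ = _ \<inter> ?C")
    using mixed_profiles_subset_coord_cube[of P B, OF fin]
    by (auto simp: mixed_profiles_def coord_cube_def)
  have "closed ?C"
    by (intro closed_INT ballI closed_Collect_eq continuous_on_sum continuous_on_coordinate
        continuous_on_const)
  then show ?thesis
    unfolding eq by (intro compact_Int_closed compact_coord_cube)
qed

text \<open>
  Missing mass is spread evenly and excess mass is divided out, which makes this map a retraction
  of the cube onto the mixed profiles.
\<close>

definition normalise :: "'p set \<Rightarrow> ('p \<Rightarrow> 'q set) \<Rightarrow> ('p \<times> 'q \<Rightarrow> real) \<Rightarrow> 'p \<times> 'q \<Rightarrow> real" where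
  "normalise P B x = (\<lambda>(i, \<alpha>). if (i, \<alpha>) \<in> Sigma P B
     then (x (i, \<alpha>) + max 0 (1 - (\<Sum>\<beta>\<in>B i. x (i, \<beta>))) / card (B i)) / max 1 (\<Sum>\<beta>\<in>B i. x (i, \<beta>))
     else 0)"

text \<open>At most one of the two corrections acts in a row, so the sum is
  \<open>s + (1 - s)\<close> over \<open>1\<close> or \<open>s\<close> over \<open>s\<close>;
  nonempty \<open>B i\<close> lets its cardinality cancel.\<close>

lemma normalise_mixed:
  assumes fin: "\<And>i. i \<in> P \<Longrightarrow> finite (B i) \<and> B i \<noteq> {}" and x: "x \<in> coord_cube (Sigma P B)"
  shows "normalise P B x \<in> mixed_profiles P B"
proof -
  have "0 \<le> x (i, \<alpha>)" if "i \<in> P" "\<alpha> \<in> B i" for i \<alpha>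
    using x that by (auto simp: coord_cube_def)
  then have nonneg: "0 \<le> normalise P B x (i, \<alpha>)" if "i \<in> P" "\<alpha> \<in> B i" for i \<alpha>
    using that by (simp add: normalise_def)
  have "(\<Sum>\<alpha>\<in>B i. normalise P B x (i, \<alpha>)) = 1" if i: "i \<in> P" for i
  proof -
    define s where "s = (\<Sum>\<beta>\<in>B i. x (i, \<beta>))"
    have "(\<Sum>\<alpha>\<in>B i. normalise P B x (i, \<alpha>))
        = (\<Sum>\<alpha>\<in>B i. (x (i, \<alpha>) + max 0 (1 - s) / card (B i)) / max 1 s)"
      using i by (intro sum.cong) (auto simp: normalise_def s_def)
    also have "\<dots> = (s + card (B i) * (max 0 (1 - s) / card (B i))) / max 1 s"
      by (simp add: sum_divide_distrib[symmetric] sum.distrib s_def)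
    also have "\<dots> = (s + max 0 (1 - s)) / max 1 s"
      using fin[OF i] by (simp add: card_gt_0_iff)
    also have "\<dots> = 1"
      by (cases "s \<le> 1") (auto simp: max_def)
    finally show ?thesis .
  qed
  then show ?thesis using nonneg by (auto simp: mixed_profiles_def normalise_def)
qed

lemma normalise_id: "x \<in> mixed_profiles P B \<Longrightarrow> normalise P B x = x"
  by (auto simp: mixed_profiles_def normalise_def fun_eq_iff)

lemma continuous_on_normalise: "continuous_on S (normalise P B)"
proof (rule continuous_on_coordinatewise_then_product)
  fix k :: "'a \<times> 'b"
  show "continuous_on S (\<lambda>x. normalise P B x k)"
  proof (cases "k \<in> Sigma P B")
    case True
    have "continuous_on S (\<lambda>x. (x k + max 0 (1 - (\<Sum>\<beta>\<in>B (fst k). x (fst k, \<beta>))) * (1 / card (B (fst k))))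
            / max 1 (\<Sum>\<beta>\<in>B (fst k). x (fst k, \<beta>)))"
      by (intro continuous_on_divide continuous_on_add continuous_on_mult continuous_on_max
          continuous_on_diff continuous_on_sum continuous_on_coordinate continuous_on_const) auto
    with True show ?thesis by (auto simp: normalise_def)
  qed (cases k, auto simp: normalise_def)
qed

text \<open>At a fixed point of the map below, the gains of a player are proportional to the
  weights. The averaging property \<open>lin\<close> provides a strategy of positive weight without
  gain, so the factor of proportionality is \<open>0\<close> and no strategy gains.\<close>

lemma finite_nash:
  fixes B :: "'p::countable \<Rightarrow> 'q::countable set" and u :: "'p \<Rightarrow> ('p \<times> 'q \<Rightarrow> real) \<Rightarrow> real"
  assumes "finite P" and fin: "\<And>i. i \<in> P \<Longrightarrow> finite (B i) \<and> B i \<noteq> {}"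
    and cont: "\<And>i. i \<in> P \<Longrightarrow> continuous_on UNIV (u i)"
    and lin: "\<And>i x. i \<in> P \<Longrightarrow> x \<in> mixed_profiles P B \<Longrightarrow>
      u i x = (\<Sum>\<alpha>\<in>B i. x (i, \<alpha>) * u i (deviate x i (pure \<alpha>)))"
  shows "\<exists>x\<in>mixed_profiles P B. \<forall>i\<in>P. \<forall>\<alpha>\<in>B i. u i (deviate x i (pure \<alpha>)) \<le> u i x"
proof -
  \<comment> \<open>Nash's map: each player shifts weight towards the strategies that gain.\<close>
  define g where "g x i \<alpha> = max 0 (u i (deviate x i (pure \<alpha>)) - u i x)" for x i \<alpha>
  define T where "T x = (\<lambda>(i, \<alpha>). if (i, \<alpha>) \<in> Sigma P B
      then (x (i, \<alpha>) + g x i \<alpha>) / (1 + (\<Sum>\<beta>\<in>B i. g x i \<beta>)) else 0)" for x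
  have g0: "0 \<le> g x i \<alpha>" for x i \<alpha> by (simp add: g_def)
  have pos: "0 < 1 + (\<Sum>\<beta>\<in>B i. g x i \<beta>)" for x i
    using g0 by (smt (verit) sum_nonneg)
  have T: "T x \<in> mixed_profiles P B" if x: "x \<in> mixed_profiles P B" for x
  proof -
    have "(\<Sum>\<alpha>\<in>B i. T x (i, \<alpha>)) = 1" if i: "i \<in> P" for i
    proof -
      have "(\<Sum>\<alpha>\<in>B i. T x (i, \<alpha>)) = (\<Sum>\<alpha>\<in>B i. (x (i, \<alpha>) + g x i \<alpha>) / (1 + (\<Sum>\<beta>\<in>B i. g x i \<beta>)))"
        using i by (intro sum.cong) (auto simp: T_def)
      also have "\<dots> = ((\<Sum>\<alpha>\<in>B i. x (i, \<alpha>)) + (\<Sum>\<beta>\<in>B i. g x i \<beta>)) / (1 + (\<Sum>\<beta>\<in>B i. g x i \<beta>))"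
        by (simp add: sum_divide_distrib[symmetric] sum.distrib)
      also have "\<dots> = 1" using x i pos[where x=x and i=i] by (simp add: mixed_profiles_def)
      finally show ?thesis .
    qed
    moreover have "0 \<le> T x (i, \<alpha>)" if "i \<in> P" "\<alpha> \<in> B i" for i \<alpha>
      using x that g0 pos[where x=x and i=i] by (auto simp: T_def mixed_profiles_def intro!: divide_nonneg_pos)
    ultimately show ?thesis by (auto simp: mixed_profiles_def T_def)
  qed
  have contg: "continuous_on UNIV (\<lambda>x. g x i \<alpha>)" if "i \<in> P" for i \<alpha>
    unfolding g_def
    by (intro continuous_on_max continuous_on_diff continuous_on_const cont[OF that]
        continuous_on_compose2[OF cont[OF that] continuous_on_deviate]) auto
  have "continuous_on UNIV (\<lambda>x. T x k)" for k
  proof (cases "k \<in> Sigma P B")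
    case True
    have "continuous_on UNIV (\<lambda>x. (x k + g x (fst k) (snd k)) / (1 + (\<Sum>\<beta>\<in>B (fst k). g x (fst k) \<beta>)))"
      using True pos
      by (intro continuous_on_divide continuous_on_add continuous_on_sum continuous_on_coordinate
          continuous_on_const contg) (auto simp: less_imp_neq[symmetric])
    with True show ?thesis by (auto simp: T_def)
  qed (cases k, auto simp: T_def)
  then have contT: "continuous_on UNIV T"
    by (rule continuous_on_coordinatewise_then_product)
  have finI: "finite (Sigma P B)" using \<open>finite P\<close> fin by blast
  \<comment> \<open>\<open>T\<close> is known to preserve only the mixed profiles, so Brouwer's
    theorem is applied to \<open>T\<close> after the retraction. The values are mixed profiles,
    hence so is the fixed point, and there the retraction is the identity.\<close>
  obtain z where z: "z \<in> coord_cube (Sigma P B)" "T (normalise P B z) = z"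
  proof (rule brouwer_coord_cube[OF finI])
    show "continuous_on (coord_cube (Sigma P B)) (\<lambda>x. T (normalise P B x))"
      by (rule continuous_on_compose2[OF contT continuous_on_normalise]) simp
    show "(\<lambda>x. T (normalise P B x)) ` coord_cube (Sigma P B) \<subseteq> coord_cube (Sigma P B)"
    proof (rule image_subsetI)
      fix x assume "x \<in> coord_cube (Sigma P B)"
      then have "T (normalise P B x) \<in> mixed_profiles P B"
        by (intro T normalise_mixed fin)
      moreover have "mixed_profiles P B \<subseteq> coord_cube (Sigma P B)"
        by (rule mixed_profiles_subset_coord_cube) (simp add: fin)
      ultimately show "T (normalise P B x) \<in> coord_cube (Sigma P B)" by blast
    qed
  qed
  have zm: "z \<in> mixed_profiles P B" using T[OF normalise_mixed[OF fin z(1)]] z(2) by simp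
  then have Tz: "T z = z" using z(2) by (simp add: normalise_id)
  have "u i (deviate z i (pure \<alpha>)) \<le> u i z" if i: "i \<in> P" and \<alpha>: "\<alpha> \<in> B i" for i \<alpha>
  proof -
    let ?w = "\<lambda>\<beta>. u i (deviate z i (pure \<beta>))"
    have z0: "0 \<le> z (i, \<beta>)" if "\<beta> \<in> B i" for \<beta> using zm i that by (simp add: mixed_profiles_def)
    have zsum: "(\<Sum>\<beta>\<in>B i. z (i, \<beta>)) = 1" using zm i by (simp add: mixed_profiles_def)
    define G where "G = (\<Sum>\<beta>\<in>B i. g z i \<beta>)"
    have fix_eq: "z (i, \<beta>) * G = g z i \<beta>" if "\<beta> \<in> B i" for \<beta>
    proof -
      have "z (i, \<beta>) = (z (i, \<beta>) + g z i \<beta>) / (1 + G)"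
        using fun_cong[OF Tz, of "(i, \<beta>)"] i that by (simp add: T_def G_def)
      then show ?thesis using pos[where x=z and i=i] by (simp add: G_def[symmetric] field_simps)
    qed
    \<comment> \<open>If every strategy of positive weight paid more than \<open>u i z\<close>, so
      would their average, which is \<open>u i z\<close> itself by \<open>lin\<close>.\<close>
    have "\<exists>\<beta>\<in>B i. 0 < z (i, \<beta>) \<and> ?w \<beta> \<le> u i z"
    proof (rule ccontr)
      assume no: "\<not> (\<exists>\<beta>\<in>B i. 0 < z (i, \<beta>) \<and> ?w \<beta> \<le> u i z)"
      then have le: "z (i, \<beta>) * u i z \<le> z (i, \<beta>) * ?w \<beta>" if "\<beta> \<in> B i" for \<beta>
        using z0[OF that] that by (cases "z (i, \<beta>) = 0") (auto intro!: mult_left_mono)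
      obtain \<beta> where \<beta>: "\<beta> \<in> B i" "0 < z (i, \<beta>)"
        using zsum z0 sum_nonpos[of "B i" "\<lambda>\<beta>. z (i, \<beta>)"] by force
      have "(\<Sum>\<beta>\<in>B i. z (i, \<beta>) * u i z) < (\<Sum>\<beta>\<in>B i. z (i, \<beta>) * ?w \<beta>)"
      proof (rule sum_strict_mono_ex1)
        show "\<exists>\<beta>\<in>B i. z (i, \<beta>) * u i z < z (i, \<beta>) * ?w \<beta>"
          using \<beta> no by (intro bexI[of _ \<beta>]) auto
      qed (use fin[OF i] le in auto)
      then show False
        using lin[OF i zm] zsum by (simp add: sum_distrib_right[symmetric])
    qed
    then obtain \<beta> where \<beta>: "\<beta> \<in> B i" "0 < z (i, \<beta>)" "?w \<beta> \<le> u i z" by blast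
    then have "g z i \<beta> = 0" by (simp add: g_def)
    then have "G = 0" using fix_eq[OF \<beta>(1)] \<beta>(2) by simp
    then have "g z i \<alpha> = 0" using fix_eq[OF \<alpha>] by simp
    then show ?thesis by (simp add: g_def)
  qed
  with zm show ?thesis by blast
qed

section \<open>Measurable selection of zeros\<close>

text \<open>The union over \<open>K\<close> may be uncountable, but a countable dense subset detects
  zeros approximately. By continuity a zero makes \<open>h \<omega>\<close> small nearby;
  conversely, by compactness the modulus of \<open>h \<omega>\<close> attains its infimum, which is
  \<open>0\<close> if arbitrarily small values occur.\<close>

lemma sets_exists_zero_compact:
  fixes h :: "'a \<Rightarrow> 'b::{metric_space, second_countable_topology} \<Rightarrow> real"
  assumes K: "compact K"
    and meas: "\<And>x. x \<in> K \<Longrightarrow> (\<lambda>\<omega>. h \<omega> x) \<in> borel_measurable M"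
    and cont: "\<And>\<omega>. \<omega> \<in> space M \<Longrightarrow> continuous_on K (h \<omega>)"
  shows "{\<omega> \<in> space M. \<exists>x\<in>K. h \<omega> x = 0} \<in> sets M"
proof -
  obtain D where D: "countable D" "D \<subseteq> K" "K \<subseteq> closure D"
    by (rule separable)
  have eq: "(\<exists>x\<in>K. h \<omega> x = 0) \<longleftrightarrow> (\<forall>k. \<exists>d\<in>D. \<bar>h \<omega> d\<bar> < 1 / Suc k)" if \<omega>: "\<omega> \<in> space M" for \<omega>
  proof
    assume "\<exists>x\<in>K. h \<omega> x = 0"
    then obtain x where x: "x \<in> K" "h \<omega> x = 0" by blast
    show "\<forall>k. \<exists>d\<in>D. \<bar>h \<omega> d\<bar> < 1 / Suc k"
    proof
      fix k
      obtain \<delta> where \<delta>: "0 < \<delta>" "\<And>y. y \<in> K \<Longrightarrow> dist y x < \<delta> \<Longrightarrow> dist (h \<omega> y) (h \<omega> x) < 1 / Suc k"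
        using cont[OF \<omega>, unfolded continuous_on_iff, rule_format, OF x(1), of "1 / Suc k"] by auto
      moreover obtain d where "d \<in> D" "dist d x < \<delta>"
        using D(3) x(1) \<delta>(1) closure_approachable by blast
      ultimately show "\<exists>d\<in>D. \<bar>h \<omega> d\<bar> < 1 / Suc k"
        using D(2) x(2) by (intro bexI[of _ d]) (auto simp: dist_real_def)
    qed
  next
    assume *: "\<forall>k. \<exists>d\<in>D. \<bar>h \<omega> d\<bar> < 1 / Suc k"
    then have "K \<noteq> {}" using D(2) by blast
    moreover have "continuous_on K (\<lambda>x. \<bar>h \<omega> x\<bar>)"
      using cont[OF \<omega>] by (rule continuous_on_rabs)
    ultimately obtain x where x: "x \<in> K" "\<And>y. y \<in> K \<Longrightarrow> \<bar>h \<omega> x\<bar> \<le> \<bar>h \<omega> y\<bar>"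
      using continuous_attains_inf[OF K] by metis
    have "\<bar>h \<omega> x\<bar> < 1 / Suc k" for k
      using * x(2) D(2) by (meson le_less_trans subsetD)
    then have "\<not> 0 < \<bar>h \<omega> x\<bar>"
      using reals_Archimedean[of "\<bar>h \<omega> x\<bar>"] by (auto simp: inverse_eq_divide dest: less_asym)
    then show "\<exists>x\<in>K. h \<omega> x = 0" using x(1) by auto
  qed
  have "{\<omega> \<in> space M. \<exists>x\<in>K. h \<omega> x = 0} = {\<omega> \<in> space M. \<forall>k. \<exists>d\<in>D. \<bar>h \<omega> d\<bar> < 1 / Suc k}"
    using eq by blast
  also have "\<dots> \<in> sets M"
  proof (rule sets.sets_Collect_countable_All, rule sets.sets_Collect_countable_Ex'[OF _ D(1)])
    fix k d assume "d \<in> D"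
    then have [measurable]: "(\<lambda>\<omega>. h \<omega> d) \<in> borel_measurable M" using D(2) meas by blast
    show "{\<omega> \<in> space M. \<bar>h \<omega> d\<bar> < 1 / Suc k} \<in> sets M" by measurable
  qed
  finally show ?thesis .
qed

text \<open>Choosing the least value of \<open>\<phi>\<close> on the random zero set makes the choice measurable.\<close>

lemma measurable_value_on_zero_set:
  fixes h :: "'a \<Rightarrow> 'b::{metric_space, second_countable_topology} \<Rightarrow> real" and \<phi> :: "'b \<Rightarrow> real"
  assumes K: "compact K"
    and meas: "\<And>x. x \<in> K \<Longrightarrow> (\<lambda>\<omega>. h \<omega> x) \<in> borel_measurable M"
    and cont: "\<And>\<omega>. \<omega> \<in> space M \<Longrightarrow> continuous_on K (h \<omega>)"
    and zero: "\<And>\<omega>. \<omega> \<in> space M \<Longrightarrow> \<exists>x\<in>K. h \<omega> x = 0"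
    and \<phi>: "continuous_on K \<phi>"
  shows "\<exists>m\<in>borel_measurable M. \<forall>\<omega>\<in>space M. \<exists>x\<in>K. h \<omega> x = 0 \<and> \<phi> x = m \<omega>"
proof -
  define m where "m \<omega> = Inf (\<phi> ` {x \<in> K. h \<omega> x = 0})" for \<omega>
  have min: "\<exists>x\<in>K. h \<omega> x = 0 \<and> \<phi> x = m \<omega> \<and> (\<forall>y\<in>K. h \<omega> y = 0 \<longrightarrow> m \<omega> \<le> \<phi> y)"
    if \<omega>: "\<omega> \<in> space M" for \<omega>
  proof -
    let ?Z = "{x \<in> K. h \<omega> x = 0}"
    have "closed ?Z"
      using continuous_closed_preimage_constant[OF cont[OF \<omega>] compact_imp_closed[OF K]] by simp
    then have "compact (K \<inter> ?Z)" using K compact_Int_closed by blast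
    moreover have "K \<inter> ?Z = ?Z" by blast
    moreover have "?Z \<noteq> {}" using zero[OF \<omega>] by blast
    moreover have "continuous_on ?Z \<phi>" by (rule continuous_on_subset[OF \<phi>]) blast
    ultimately obtain x where x: "x \<in> ?Z" "\<And>y. y \<in> ?Z \<Longrightarrow> \<phi> x \<le> \<phi> y"
      using continuous_attains_inf[of ?Z \<phi>] by auto
    then have "m \<omega> = \<phi> x"
      unfolding m_def by (intro cInf_eq_minimum) auto
    with x show ?thesis by auto
  qed
  have "m \<in> borel_measurable M"
  proof (rule borel_measurableI_le)
    fix c
    \<comment> \<open>As the minimum is attained, \<open>m \<omega> \<le> c\<close> means that the
      zero set meets a sublevel set of \<open>\<phi>\<close>. The latter is compact and independent
      of \<open>\<omega>\<close>, so \<open>sets_exists_zero_compact\<close> applies to it in place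
      of \<open>K\<close>.\<close>
    have "{\<omega> \<in> space M. m \<omega> \<le> c} = {\<omega> \<in> space M. \<exists>x\<in>{x \<in> K. \<phi> x \<le> c}. h \<omega> x = 0}"
      using min by (auto intro: order_trans) (metis (mono_tags))
    also have "\<dots> \<in> sets M"
    proof (rule sets_exists_zero_compact)
      have "closed {x \<in> K. \<phi> x \<le> c}"
        using continuous_on_closed_Collect_le[OF \<phi> _ compact_imp_closed[OF K], of "\<lambda>_. c"] by simp
      moreover have "K \<inter> {x \<in> K. \<phi> x \<le> c} = {x \<in> K. \<phi> x \<le> c}" by blast
      ultimately show "compact {x \<in> K. \<phi> x \<le> c}"
        using compact_Int_closed[OF K] by metis
      show "continuous_on {x \<in> K. \<phi> x \<le> c} (h \<omega>)" if "\<omega> \<in> space M" for \<omega>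
        using cont[OF that] by (rule continuous_on_subset) blast
    qed (use meas in blast)
    finally show "{\<omega> \<in> space M. m \<omega> \<le> c} \<in> sets M" .
  qed
  then show ?thesis using min by (intro bexI[of _ m]) blast+
qed

text \<open>The coordinates in \<open>I\<close> are settled one after the other; the invariant is
  that at every \<open>\<omega>\<close> some zero in \<open>K\<close> has the values chosen so far.
  Since points of \<open>K\<close> vanish off \<open>I\<close>, the values on \<open>I\<close>
  determine that zero, so the selected coordinates really are those of a zero in
  \<open>K\<close>.\<close>

lemma measurable_zero_selection:
  fixes h :: "'a \<Rightarrow> ('i::countable \<Rightarrow> real) \<Rightarrow> real"
  assumes K: "compact K"
    and meas: "\<And>x. x \<in> K \<Longrightarrow> (\<lambda>\<omega>. h \<omega> x) \<in> borel_measurable M"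
    and cont: "\<And>\<omega>. \<omega> \<in> space M \<Longrightarrow> continuous_on K (h \<omega>)"
    and zero: "\<And>\<omega>. \<omega> \<in> space M \<Longrightarrow> \<exists>x\<in>K. h \<omega> x = 0"
    and "finite I" and supp: "\<And>x i. x \<in> K \<Longrightarrow> i \<notin> I \<Longrightarrow> x i = 0"
  shows "\<exists>s. (\<forall>i. (\<lambda>\<omega>. s \<omega> i) \<in> borel_measurable M) \<and>
      (\<forall>\<omega>\<in>space M. s \<omega> \<in> K \<and> h \<omega> (s \<omega>) = 0)"
proof -
  have "\<exists>m. (\<forall>i. m i \<in> borel_measurable M) \<and>
          (\<forall>\<omega>\<in>space M. \<exists>x\<in>K. h \<omega> x = 0 \<and> (\<forall>i\<in>I. x i = m i \<omega>))"
    using \<open>finite I\<close>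
  proof (induction I)
    case empty
    show ?case using zero by (intro exI[of _ "\<lambda>_ _. 0"]) auto
  next
    case (insert j J)
    then obtain m where m: "\<And>i. m i \<in> borel_measurable M"
      and ex: "\<And>\<omega>. \<omega> \<in> space M \<Longrightarrow> \<exists>x\<in>K. h \<omega> x = 0 \<and> (\<forall>i\<in>J. x i = m i \<omega>)"
      by blast
    \<comment> \<open>The values already chosen become further equations. The enlarged function is
      again measurable in \<open>\<omega>\<close> and continuous in \<open>x\<close>, so the next
      coordinate is covered by \<open>measurable_value_on_zero_set\<close>.\<close>
    define h' where "h' \<omega> x = \<bar>h \<omega> x\<bar> + (\<Sum>i\<in>J. \<bar>x i - m i \<omega>\<bar>)" for \<omega> x
    have h'_0: "h' \<omega> x = 0 \<longleftrightarrow> h \<omega> x = 0 \<and> (\<forall>i\<in>J. x i = m i \<omega>)" for \<omega> x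
      using insert.hyps(1) by (simp add: h'_def add_nonneg_eq_0_iff sum_nonneg sum_nonneg_eq_0_iff)
    have "\<exists>m\<^sub>j\<in>borel_measurable M. \<forall>\<omega>\<in>space M. \<exists>x\<in>K. h' \<omega> x = 0 \<and> x j = m\<^sub>j \<omega>"
    proof (rule measurable_value_on_zero_set[OF K])
      show "(\<lambda>\<omega>. h' \<omega> x) \<in> borel_measurable M" if "x \<in> K" for x
        using meas[OF that] m unfolding h'_def by measurable
      show "continuous_on K (h' \<omega>)" if "\<omega> \<in> space M" for \<omega>
        unfolding h'_def
        by (intro continuous_on_add continuous_on_rabs continuous_on_sum continuous_on_diff
            continuous_on_const cont[OF that] continuous_on_coordinate)
      show "\<exists>x\<in>K. h' \<omega> x = 0" if "\<omega> \<in> space M" for \<omega>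
        using ex[OF that] h'_0 by blast
      show "continuous_on K (\<lambda>x. x j)" by (rule continuous_on_coordinate)
    qed
    then obtain m\<^sub>j where mj: "m\<^sub>j \<in> borel_measurable M"
      and ex': "\<And>\<omega>. \<omega> \<in> space M \<Longrightarrow> \<exists>x\<in>K. h' \<omega> x = 0 \<and> x j = m\<^sub>j \<omega>"
      by blast
    show ?case
    proof (intro exI[of _ "m(j := m\<^sub>j)"] conjI allI ballI)
      show "(m(j := m\<^sub>j)) i \<in> borel_measurable M" for i using m mj by simp
      fix \<omega> assume "\<omega> \<in> space M"
      from ex'[OF this] show "\<exists>x\<in>K. h \<omega> x = 0 \<and> (\<forall>i\<in>insert j J. x i = (m(j := m\<^sub>j)) i \<omega>)"
        using insert.hyps(2) by (auto simp: h'_0)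
    qed
  qed
  then obtain m where m: "\<And>i. m i \<in> borel_measurable M"
    and ex: "\<And>\<omega>. \<omega> \<in> space M \<Longrightarrow> \<exists>x\<in>K. h \<omega> x = 0 \<and> (\<forall>i\<in>I. x i = m i \<omega>)"
    by blast
  define s where "s \<omega> = (\<lambda>i. if i \<in> I then m i \<omega> else 0)" for \<omega>
  have "s \<omega> \<in> K \<and> h \<omega> (s \<omega>) = 0" if "\<omega> \<in> space M" for \<omega>
  proof -
    obtain x where x: "x \<in> K" "h \<omega> x = 0" "\<forall>i\<in>I. x i = m i \<omega>" using ex[OF \<open>\<omega> \<in> space M\<close>] by blast
    then have "s \<omega> = x" using supp by (auto simp: s_def fun_eq_iff)
    with x show ?thesis by simp
  qed
  moreover have "(\<lambda>\<omega>. s \<omega> i) \<in> borel_measurable M" for i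
    using m by (simp add: s_def)
  ultimately show ?thesis by blast
qed

section \<open>Barycentric coordinates in \<open>L\<^sup>0\<close>-simplexes\<close>

lemma L0_finsum_class:
  fixes f :: "'i \<Rightarrow> 'a \<Rightarrow> 'k::real_or_complex"
  assumes "finite I" "\<And>i. i \<in> I \<Longrightarrow> f i \<in> borel_measurable M"
  shows "(\<Oplus>\<^bsub>L0 M\<^esub>i\<in>I. ae_class M (f i)) = ae_class M (\<lambda>\<omega>. \<Sum>i\<in>I. f i \<omega>)"
proof -
  interpret cring "L0 M :: ('a \<Rightarrow> 'k) set ring" by (rule cring_L0)
  show ?thesis
    using assms
  proof (induction I)
    case empty
    then show ?case by (simp add: L0_zero)
  next
    case (insert i I)
    have "(\<Oplus>\<^bsub>L0 M\<^esub>j\<in>insert i I. ae_class M (f j))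
        = ae_class M (f i) \<oplus>\<^bsub>L0 M\<^esub> (\<Oplus>\<^bsub>L0 M\<^esub>j\<in>I. ae_class M (f j))"
      using insert by (intro finsum_insert) (auto simp: carrier_L0)
    also have "\<dots> = ae_class M (f i) \<oplus>\<^bsub>L0 M\<^esub> ae_class M (\<lambda>\<omega>. \<Sum>j\<in>I. f j \<omega>)"
      using insert by simp
    also have "\<dots> = ae_class M (\<lambda>\<omega>. \<Sum>j\<in>insert i I. f j \<omega>)"
      using insert by (subst L0_add_class) auto
    finally show ?case .
  qed
qed

lemma L0_one_minus_class:
  fixes f :: "'a \<Rightarrow> 'k::real_or_complex"
  assumes "f \<in> borel_measurable M"
  shows "\<one>\<^bsub>L0 M\<^esub> \<ominus>\<^bsub>L0 M\<^esub> ae_class M f = ae_class M (\<lambda>\<omega>. 1 - f \<omega>)"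
proof -
  interpret cring "L0 M :: ('a \<Rightarrow> 'k) set ring" by (rule cring_L0)
  have "\<ominus>\<^bsub>L0 M\<^esub> ae_class M f = ae_class M (\<lambda>\<omega>. - f \<omega>)"
    using assms by (intro minus_equality) (auto simp: carrier_L0 L0_add_class L0_zero)
  then show ?thesis
    using assms by (simp add: a_minus_def L0_one L0_add_class)
qed

lemma l0_le_class_iff:
  assumes "f \<in> borel_measurable M" "g \<in> borel_measurable M"
  shows "l0_le M (ae_class M f) (ae_class M g) \<longleftrightarrow> (AE \<omega> in M. f \<omega> \<le> g \<omega>)"
proof
  assume "l0_le M (ae_class M f) (ae_class M g)"
  then obtain f' g' where "AE \<omega> in M. f \<omega> = f' \<omega>" "AE \<omega> in M. g \<omega> = g' \<omega>" "AE \<omega> in M. f' \<omega> \<le> g' \<omega>"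
    by (auto simp: l0_le_def in_ae_class_iff)
  then show "AE \<omega> in M. f \<omega> \<le> g \<omega>" by eventually_elim simp
next
  assume "AE \<omega> in M. f \<omega> \<le> g \<omega>"
  then show "l0_le M (ae_class M f) (ae_class M g)"
    unfolding l0_le_def using assms by (intro bexI[of _ f] bexI[of _ g]) (auto simp: in_ae_class_iff)
qed

lemma L0_nonneg_class_iff:
  assumes "f \<in> borel_measurable M"
  shows "ae_class M f \<in> L0_nonneg M \<longleftrightarrow> (AE \<omega> in M. 0 \<le> f \<omega>)"
  using assms by (auto simp: L0_nonneg_def carrier_L0 L0_zero l0_le_class_iff)

lemma borel_measurable_of_real_scalar:
  fixes f :: "'a \<Rightarrow> real"
  assumes "f \<in> borel_measurable M"
  shows "(\<lambda>\<omega>. of_real (f \<omega>) :: 'k::real_or_complex) \<in> borel_measurable M"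
proof -
  have "(of_real :: real \<Rightarrow> 'k) \<in> borel_measurable borel"
    by (intro borel_measurable_continuous_onI continuous_intros)
  from measurable_compose[OF assms this] show ?thesis .
qed

lemma l0_of_real_class:
  assumes "f \<in> borel_measurable M"
  shows "l0_of_real M (ae_class M f) = (ae_class M (\<lambda>\<omega>. of_real (f \<omega>)) :: ('a \<Rightarrow> 'k::real_or_complex) set)"
  unfolding l0_of_real_def using assms borel_measurable_of_real_scalar[of "\<lambda>x. x" borel]
  by (intro l0_map_class) auto

section \<open>Points of a simplex given by random weights\<close>

lemma l0_conv_mono: "G \<subseteq> H \<Longrightarrow> l0_conv M E G \<subseteq> l0_conv M E H"
  unfolding l0_conv_def by blast

text \<open>The conditions are imposed everywhere on \<open>space M\<close>, not only almost
  everywhere, so that weights can be divided and summed pointwise without exceptional sets.\<close>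

definition stochastic :: "'a measure \<Rightarrow> 'q set \<Rightarrow> ('q \<Rightarrow> 'a \<Rightarrow> real) \<Rightarrow> bool" where
  "stochastic M A f \<longleftrightarrow> (\<forall>\<alpha>\<in>A. f \<alpha> \<in> borel_measurable M) \<and>
     (\<forall>\<omega>\<in>space M. (\<forall>\<alpha>\<in>A. 0 \<le> f \<alpha> \<omega>) \<and> (\<Sum>\<alpha>\<in>A. f \<alpha> \<omega>) = 1)"

text \<open>The weights are representatives rather than classes, which allows them to be edited
  pointwise; by \<open>l0_point_cong\<close> the point depends only on their classes.\<close>

definition l0_point ::
  "'a measure \<Rightarrow> (('a \<Rightarrow> 'k::real_or_complex) set, 'e) module \<Rightarrow> 'q set \<Rightarrow> ('q \<Rightarrow> 'a \<Rightarrow> real)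
     \<Rightarrow> ('q \<Rightarrow> 'e) \<Rightarrow> 'e" where
  "l0_point M E A f v = (\<Oplus>\<^bsub>E\<^esub>\<alpha>\<in>A. l0_of_real M (ae_class M (f \<alpha>)) \<odot>\<^bsub>E\<^esub> v \<alpha>)"

text \<open>On the null set where the conditions fail, the weights are replaced by those of the
  single vertex \<open>\<beta>\<close>. That set is measurable because \<open>A\<close> is
  finite.\<close>

lemma stochastic_mixture:
  assumes "finite A" "\<beta> \<in> A"
    and meas: "\<And>\<alpha>. \<alpha> \<in> A \<Longrightarrow> f \<alpha> \<in> borel_measurable M"
    and AE: "AE \<omega> in M. (\<forall>\<alpha>\<in>A. 0 \<le> f \<alpha> \<omega>) \<and> (\<Sum>\<alpha>\<in>A. f \<alpha> \<omega>) = 1"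
  obtains g where "stochastic M A g" "\<And>\<alpha>. \<alpha> \<in> A \<Longrightarrow> AE \<omega> in M. f \<alpha> \<omega> = g \<alpha> \<omega>"
proof
  define good where "good \<omega> \<longleftrightarrow> (\<forall>\<alpha>\<in>A. 0 \<le> f \<alpha> \<omega>) \<and> (\<Sum>\<alpha>\<in>A. f \<alpha> \<omega>) = 1" for \<omega>
  define g where "g \<alpha> \<omega> = (if good \<omega> then f \<alpha> \<omega> else if \<alpha> = \<beta> then 1 else 0)" for \<alpha> \<omega>
  have good: "Measurable.pred M good"
    unfolding good_def using \<open>finite A\<close> meas
    by (intro pred_intros_logic pred_intros_finite borel_measurable_sum) (auto intro!: measurable_sets_Collect)
  then have "g \<alpha> \<in> borel_measurable M" if "\<alpha> \<in> A" for \<alpha>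
    unfolding g_def using meas[OF that] by (intro measurable_If) (auto simp: pred_def)
  moreover have "(\<Sum>\<alpha>\<in>A. g \<alpha> \<omega>) = 1" for \<omega>
  proof (cases "good \<omega>")
    case True
    then show ?thesis by (simp add: g_def) (simp add: good_def)
  qed (use assms(1,2) in \<open>simp add: g_def\<close>)
  moreover have "0 \<le> g \<alpha> \<omega>" if "\<alpha> \<in> A" for \<alpha> \<omega>
    using that by (simp add: g_def good_def)
  ultimately show "stochastic M A g"
    by (simp add: stochastic_def)
  show "AE \<omega> in M. f \<alpha> \<omega> = g \<alpha> \<omega>" for \<alpha>
    using AE by eventually_elim (simp add: g_def good_def)
qed

text \<open>In the proofs below, facts with the prefix \<open>M.\<close> belong to the additive
  group of \<open>E\<close>, as named in \<open>module\<close>; the measure \<open>M\<close> is not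
  meant.\<close>

locale l0_module = module "L0 M" E
  for M :: "'a measure" and E :: "(('a \<Rightarrow> 'k::real_or_complex) set, 'e) module"
begin

lemma real_class_closed [simp]:
  assumes "f \<in> borel_measurable M"
  shows "l0_of_real M (ae_class M f) \<in> carrier (L0 M :: ('a \<Rightarrow> 'k) set ring)"
  using borel_measurable_of_real_scalar[OF assms, where 'k='k] by (simp add: l0_of_real_class[OF assms] carrier_L0)

lemma real_class_add:
  assumes "f \<in> borel_measurable M" "g \<in> borel_measurable M"
  shows "l0_of_real M (ae_class M (\<lambda>\<omega>. f \<omega> + g \<omega>))
    = l0_of_real M (ae_class M f) \<oplus>\<^bsub>L0 M\<^esub> (l0_of_real M (ae_class M g) :: ('a \<Rightarrow> 'k) set)"
  using assms borel_measurable_of_real_scalar[OF assms(1), where 'k='k] borel_measurable_of_real_scalar[OF assms(2), where 'k='k]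
  by (simp add: l0_of_real_class L0_add_class)

lemma real_class_mult:
  assumes "f \<in> borel_measurable M" "g \<in> borel_measurable M"
  shows "l0_of_real M (ae_class M (\<lambda>\<omega>. f \<omega> * g \<omega>))
    = l0_of_real M (ae_class M f) \<otimes>\<^bsub>L0 M\<^esub> (l0_of_real M (ae_class M g) :: ('a \<Rightarrow> 'k) set)"
  using assms borel_measurable_of_real_scalar[OF assms(1), where 'k='k] borel_measurable_of_real_scalar[OF assms(2), where 'k='k]
  by (simp add: l0_of_real_class L0_mult_class)

lemma real_class_zero: "l0_of_real M (ae_class M (\<lambda>_. 0)) = (\<zero>\<^bsub>L0 M\<^esub> :: ('a \<Rightarrow> 'k) set)"
  and real_class_one: "l0_of_real M (ae_class M (\<lambda>_. 1)) = (\<one>\<^bsub>L0 M\<^esub> :: ('a \<Rightarrow> 'k) set)"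
  by (simp_all add: l0_of_real_class L0_zero L0_one)

lemma l0_point_cong:
  assumes "\<And>\<alpha>. \<alpha> \<in> A \<Longrightarrow> f \<alpha> \<in> borel_measurable M" "\<And>\<alpha>. \<alpha> \<in> A \<Longrightarrow> g \<alpha> \<in> borel_measurable M"
    and "\<And>\<alpha>. \<alpha> \<in> A \<Longrightarrow> AE \<omega> in M. f \<alpha> \<omega> = g \<alpha> \<omega>" and "v ` A \<subseteq> carrier E"
  shows "l0_point M E A f v = l0_point M E A g v"
  unfolding l0_point_def
proof (rule M.finsum_cong')
  show "l0_of_real M (ae_class M (f \<alpha>)) \<odot>\<^bsub>E\<^esub> v \<alpha> = l0_of_real M (ae_class M (g \<alpha>)) \<odot>\<^bsub>E\<^esub> v \<alpha>"
    if "\<alpha> \<in> A" for \<alpha>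
    using that assms ae_class_eq_iff[of "f \<alpha>" M "g \<alpha>"] by simp
  show "(\<lambda>\<alpha>. l0_of_real M (ae_class M (g \<alpha>)) \<odot>\<^bsub>E\<^esub> v \<alpha>) \<in> A \<rightarrow> carrier E"
    using assms(2,4) by auto
qed simp

lemma l0_point_closed:
  assumes "\<And>\<alpha>. \<alpha> \<in> A \<Longrightarrow> f \<alpha> \<in> borel_measurable M" and "v ` A \<subseteq> carrier E"
  shows "l0_point M E A f v \<in> carrier E"
  unfolding l0_point_def using assms by (intro M.finsum_closed) auto

lemma l0_point_add:
  assumes "\<And>\<alpha>. \<alpha> \<in> A \<Longrightarrow> f \<alpha> \<in> borel_measurable M" "\<And>\<alpha>. \<alpha> \<in> A \<Longrightarrow> g \<alpha> \<in> borel_measurable M"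
    and "v ` A \<subseteq> carrier E"
  shows "l0_point M E A (\<lambda>\<alpha> \<omega>. f \<alpha> \<omega> + g \<alpha> \<omega>) v = l0_point M E A f v \<oplus>\<^bsub>E\<^esub> l0_point M E A g v"
proof -
  have "l0_point M E A (\<lambda>\<alpha> \<omega>. f \<alpha> \<omega> + g \<alpha> \<omega>) v =
    (\<Oplus>\<^bsub>E\<^esub>\<alpha>\<in>A. l0_of_real M (ae_class M (f \<alpha>)) \<odot>\<^bsub>E\<^esub> v \<alpha> \<oplus>\<^bsub>E\<^esub> l0_of_real M (ae_class M (g \<alpha>)) \<odot>\<^bsub>E\<^esub> v \<alpha>)"
    unfolding l0_point_def using assms
    by (intro M.finsum_cong') (auto simp: real_class_add smult_l_distr image_subset_iff)
  also have "\<dots> = l0_point M E A f v \<oplus>\<^bsub>E\<^esub> l0_point M E A g v"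
    unfolding l0_point_def using assms by (intro M.finsum_addf) auto
  finally show ?thesis .
qed

lemma l0_point_smult:
  assumes "finite A" "\<And>\<alpha>. \<alpha> \<in> A \<Longrightarrow> f \<alpha> \<in> borel_measurable M" and h: "h \<in> borel_measurable M"
    and "v ` A \<subseteq> carrier E"
  shows "l0_point M E A (\<lambda>\<alpha> \<omega>. h \<omega> * f \<alpha> \<omega>) v = l0_of_real M (ae_class M h) \<odot>\<^bsub>E\<^esub> l0_point M E A f v"
proof -
  have "l0_of_real M (ae_class M h) \<odot>\<^bsub>E\<^esub> l0_point M E A f v
      = (\<Oplus>\<^bsub>E\<^esub>\<alpha>\<in>A. l0_of_real M (ae_class M h) \<odot>\<^bsub>E\<^esub> (l0_of_real M (ae_class M (f \<alpha>)) \<odot>\<^bsub>E\<^esub> v \<alpha>))"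
    unfolding l0_point_def using assms by (intro finsum_smult_ldistr) auto
  also have "\<dots> = l0_point M E A (\<lambda>\<alpha> \<omega>. h \<omega> * f \<alpha> \<omega>) v"
    unfolding l0_point_def using assms
    by (intro M.finsum_cong') (auto simp: real_class_mult smult_assoc1 image_subset_iff)
  finally show ?thesis by simp
qed

lemma l0_point_delta:
  assumes "finite A" "\<beta> \<in> A" and h: "h \<in> borel_measurable M" and v: "v ` A \<subseteq> carrier E"
  shows "l0_point M E A (\<lambda>\<alpha> \<omega>. if \<beta> = \<alpha> then h \<omega> else 0) v = l0_of_real M (ae_class M h) \<odot>\<^bsub>E\<^esub> v \<beta>"
proof -
  have "l0_point M E A (\<lambda>\<alpha> \<omega>. if \<beta> = \<alpha> then h \<omega> else 0) v
     = (\<Oplus>\<^bsub>E\<^esub>\<alpha>\<in>A. if \<beta> = \<alpha> then l0_of_real M (ae_class M h) \<odot>\<^bsub>E\<^esub> v \<alpha> else \<zero>\<^bsub>E\<^esub>)"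
    unfolding l0_point_def using assms
    by (intro M.finsum_cong') (auto simp: real_class_zero image_subset_iff)
  also have "\<dots> = l0_of_real M (ae_class M h) \<odot>\<^bsub>E\<^esub> v \<beta>"
    using assms by (intro M.finsum_singleton) auto
  finally show ?thesis .
qed

lemma l0_point_vertex:
  assumes "finite A" "\<beta> \<in> A" and v: "v ` A \<subseteq> carrier E"
  shows "l0_point M E A (\<lambda>\<alpha> _. if \<beta> = \<alpha> then 1 else 0) v = v \<beta>"
  using l0_point_delta[OF assms(1,2) _ v, of "\<lambda>_. 1"] assms by (auto simp: real_class_one)

lemma l0_point_in_conv:
  fixes m :: nat
  assumes "1 \<le> m" "stochastic M {1..m} f"
  shows "l0_point M E {1..m} f v \<in> l0_conv M E (v ` {1..m})"
proof -
  have f: "f i \<in> borel_measurable M" if "i \<in> {1..m}" for i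
    using that assms(2) by (simp add: stochastic_def)
  have "(\<Oplus>\<^bsub>L0 M\<^esub>i\<in>{1..m}. ae_class M (f i)) = ae_class M (\<lambda>\<omega>. \<Sum>i\<in>{1..m}. f i \<omega>)"
    using f by (intro L0_finsum_class) auto
  also have "\<dots> = \<one>\<^bsub>L0 M\<^esub>"
    unfolding L0_one using assms(2) f by (subst ae_class_eq_iff) (auto simp: stochastic_def)
  finally have "(\<Oplus>\<^bsub>L0 M\<^esub>i\<in>{1..m}. ae_class M (f i)) = \<one>\<^bsub>L0 M\<^esub>" .
  moreover have "(\<lambda>i. ae_class M (f i)) \<in> {1..m} \<rightarrow> L0_nonneg M"
    using f assms(2) by (auto simp: L0_nonneg_class_iff stochastic_def)
  ultimately have "1 \<le> m \<and> v \<in> {1..m} \<rightarrow> v ` {1..m} \<and> (\<lambda>i. ae_class M (f i)) \<in> {1..m} \<rightarrow> L0_nonneg M \<and>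
      (\<Oplus>\<^bsub>L0 M\<^esub>i\<in>{1..m}. ae_class M (f i)) = \<one>\<^bsub>L0 M\<^esub>"
    using assms(1) by auto
  then show ?thesis
    unfolding l0_conv_def l0_point_def
    by (intro CollectI exI[where x=m] exI[where x="\<lambda>i. ae_class M (f i)"] exI[where x=v] conjI[OF refl])
qed

text \<open>The given combination may have any length and repeat vertices, so the coefficients that
  belong to the same vertex are added up. The resulting weights satisfy the conditions only almost
  everywhere, and \<open>stochastic_mixture\<close> repairs them.\<close>

lemma l0_conv_point:
  assumes N: "1 \<le> (N::nat)" and v: "v ` {1..N} \<subseteq> carrier E" and t: "t \<in> l0_conv M E (v ` {1..N})"
  obtains f where "stochastic M {1..N} f" "t = l0_point M E {1..N} f v"
proof -
  obtain m :: nat and \<xi> x where t_eq: "t = (\<Oplus>\<^bsub>E\<^esub>i\<in>{1..m}. l0_of_real M (\<xi> i) \<odot>\<^bsub>E\<^esub> x i)"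
    and x: "x \<in> {1..m} \<rightarrow> v ` {1..N}" and \<xi>: "\<xi> \<in> {1..m} \<rightarrow> L0_nonneg M"
    and sum1: "(\<Oplus>\<^bsub>L0 M\<^esub>i\<in>{1..m}. \<xi> i) = \<one>\<^bsub>L0 M\<^esub>"
    using t unfolding l0_conv_def by blast
  have "\<exists>c. c \<in> {1..N} \<and> x i = v c" if "i \<in> {1..m}" for i
    using x that by blast
  then obtain c where c: "\<And>i. i \<in> {1..m} \<Longrightarrow> c i \<in> {1..N}" "\<And>i. i \<in> {1..m} \<Longrightarrow> x i = v (c i)"
    by metis
  have "\<exists>g. g \<in> borel_measurable M \<and> \<xi> i = ae_class M g" if "i \<in> {1..m}" for i
  proof -
    have "\<xi> i \<in> carrier (L0 M)" using funcset_mem[OF \<xi> that] by (simp add: L0_nonneg_def)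
    then show ?thesis by (auto simp: carrier_L0)
  qed
  then obtain g where g: "\<And>i. i \<in> {1..m} \<Longrightarrow> g i \<in> borel_measurable M"
    "\<And>i. i \<in> {1..m} \<Longrightarrow> \<xi> i = ae_class M (g i)"
    by metis
  \<comment> \<open>\<open>F K \<alpha>\<close> collects the coefficients of those indices in
    \<open>K\<close> that are sent to the vertex \<open>\<alpha>\<close>; \<open>K\<close> is a
    parameter for the sake of the induction.\<close>
  define F where "F K \<alpha> \<omega> = (\<Sum>i\<in>K. if c i = \<alpha> then g i \<omega> else 0)" for K \<alpha> \<omega>
  have F_meas: "F K \<alpha> \<in> borel_measurable M" if "K \<subseteq> {1..m}" for K \<alpha>
    unfolding F_def using that g(1) by (intro borel_measurable_sum) auto
  have "(\<Oplus>\<^bsub>E\<^esub>i\<in>K. l0_of_real M (\<xi> i) \<odot>\<^bsub>E\<^esub> x i) = l0_point M E {1..N} (F K) v"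
    if "finite K" "K \<subseteq> {1..m}" for K
    using that
  proof (induction K)
    case empty
    have "l0_point M E {1..N} (F {}) v = (\<Oplus>\<^bsub>E\<^esub>\<alpha>\<in>{1..N}. \<zero>\<^bsub>E\<^esub>)"
      unfolding l0_point_def F_def using v
      by (intro M.finsum_cong') (auto simp: real_class_zero image_subset_iff)
    then show ?case by simp
  next
    case (insert k K)
    then have k: "k \<in> {1..m}" and K: "K \<subseteq> {1..m}" by auto
    have "(\<Oplus>\<^bsub>E\<^esub>i\<in>insert k K. l0_of_real M (\<xi> i) \<odot>\<^bsub>E\<^esub> x i)
       = l0_of_real M (\<xi> k) \<odot>\<^bsub>E\<^esub> x k \<oplus>\<^bsub>E\<^esub> (\<Oplus>\<^bsub>E\<^esub>i\<in>K. l0_of_real M (\<xi> i) \<odot>\<^bsub>E\<^esub> x i)"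
    proof (rule M.finsum_insert)
      have "l0_of_real M (\<xi> i) \<odot>\<^bsub>E\<^esub> x i \<in> carrier E" if "i \<in> {1..m}" for i
        using g[OF that] c[OF that] v by (intro smult_closed) auto
      then show "(\<lambda>i. l0_of_real M (\<xi> i) \<odot>\<^bsub>E\<^esub> x i) \<in> K \<rightarrow> carrier E"
        "l0_of_real M (\<xi> k) \<odot>\<^bsub>E\<^esub> x k \<in> carrier E" using k K by auto
    qed (use insert in auto)
    also have "\<dots> = l0_of_real M (ae_class M (g k)) \<odot>\<^bsub>E\<^esub> v (c k) \<oplus>\<^bsub>E\<^esub> l0_point M E {1..N} (F K) v"
      using insert.IH[OF K] g(2)[OF k] c(2)[OF k] by simp
    also have "\<dots> = l0_point M E {1..N} (\<lambda>\<alpha> \<omega>. if c k = \<alpha> then g k \<omega> else 0) v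
        \<oplus>\<^bsub>E\<^esub> l0_point M E {1..N} (F K) v"
      using c(1)[OF k] g(1)[OF k] v by (subst l0_point_delta) auto
    also have "\<dots> = l0_point M E {1..N} (F (insert k K)) v"
    proof -
      have "F (insert k K) = (\<lambda>\<alpha> \<omega>. (if c k = \<alpha> then g k \<omega> else 0) + F K \<alpha> \<omega>)"
        using insert.hyps by (simp add: F_def fun_eq_iff)
      then show ?thesis
        using g(1)[OF k] F_meas[OF K] v l0_point_add[where A="{1..N}" and g="F K"] by simp
    qed
    finally show ?case .
  qed
  then have t_F: "t = l0_point M E {1..N} (F {1..m}) v"
    unfolding t_eq by simp
  interpret L: cring "L0 M :: ('a \<Rightarrow> real) set ring" by (rule cring_L0)
  have "AE \<omega> in M. \<forall>i\<in>{1..m}. 0 \<le> g i \<omega>"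
    using \<xi> g by (intro AE_finite_allI) (auto simp: L0_nonneg_class_iff[symmetric] Pi_iff)
  moreover have "AE \<omega> in M. (\<Sum>i\<in>{1..m}. g i \<omega>) = 1"
  proof -
    have "ae_class M (\<lambda>\<omega>. \<Sum>i\<in>{1..m}. g i \<omega>) = (\<Oplus>\<^bsub>L0 M\<^esub>i\<in>{1..m}. ae_class M (g i))"
      using g(1) by (intro L0_finsum_class[symmetric]) auto
    also have "\<dots> = (\<Oplus>\<^bsub>L0 M\<^esub>i\<in>{1..m}. \<xi> i)"
      using g by (intro L.finsum_cong') (auto simp: carrier_L0)
    also have "\<dots> = ae_class M (\<lambda>_. 1)" using sum1 by (simp add: L0_one)
    finally show ?thesis using g(1) by (subst (asm) ae_class_eq_iff) auto
  qed
  ultimately have AE: "AE \<omega> in M. (\<forall>\<alpha>\<in>{1..N}. 0 \<le> F {1..m} \<alpha> \<omega>) \<and> (\<Sum>\<alpha>\<in>{1..N}. F {1..m} \<alpha> \<omega>) = 1"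
  proof eventually_elim
    case (elim \<omega>)
    have "(\<Sum>\<alpha>\<in>{1..N}. F {1..m} \<alpha> \<omega>) = (\<Sum>i\<in>{1..m}. \<Sum>\<alpha>\<in>{1..N}. if c i = \<alpha> then g i \<omega> else 0)"
      unfolding F_def by (rule sum.swap)
    also have "\<dots> = (\<Sum>i\<in>{1..m}. g i \<omega>)"
      using c(1) by (intro sum.cong) (auto simp: sum.delta')
    finally show ?case using elim by (auto simp: F_def intro!: sum_nonneg)
  qed
  \<comment> \<open>Vertex \<open>1\<close>, available because \<open>1 \<le> N\<close>, carries the
    whole weight on the exceptional set.\<close>
  obtain f where f: "stochastic M {1..N} f" "\<And>\<alpha>. \<alpha> \<in> {1..N} \<Longrightarrow> AE \<omega> in M. F {1..m} \<alpha> \<omega> = f \<alpha> \<omega>"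
    using stochastic_mixture[OF _ _ F_meas AE, of 1] N by auto
  have "t = l0_point M E {1..N} f v"
    unfolding t_F using f F_meas v by (intro l0_point_cong) (auto simp: stochastic_def)
  with f(1) show ?thesis by (rule that)
qed

lemma vertex_in_conv:
  fixes N :: nat
  assumes "\<beta> \<in> {1..N}" "v ` {1..N} \<subseteq> carrier E"
  shows "v \<beta> \<in> l0_conv M E (v ` {1..N})"
proof -
  have "stochastic M {1..N} (\<lambda>\<alpha> _. if \<beta> = \<alpha> then 1 else 0)"
    using assms(1) by (auto simp: stochastic_def)
  from l0_point_in_conv[OF _ this, of v] show ?thesis
    using l0_point_vertex[OF _ assms] assms(1) by simp
qed

text \<open>Affinity speaks of two points only, so the combination is built one vertex at a time: a
  point on \<open>Suc m\<close> vertices combines a point on the leading \<open>m\<close> vertices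
  with the last one. The domain stays the hull of all \<open>N\<close> vertices, so that the same
  hypothesis on \<open>F\<close> serves every step.\<close>

lemma l0_affine_point:
  fixes N :: nat
  assumes F: "l0_affine_on M E (l0_conv M E (v ` {1..N})) F" and v: "v ` {1..N} \<subseteq> carrier E"
    and a: "\<And>\<alpha>. \<alpha> \<in> {1..N} \<Longrightarrow> a \<alpha> \<in> borel_measurable M"
    and Fv: "\<And>\<alpha>. \<alpha> \<in> {1..N} \<Longrightarrow> F (v \<alpha>) = ae_class M (a \<alpha>)"
    and "1 \<le> m" "m \<le> N" "stochastic M {1..m} f"
  shows "F (l0_point M E {1..m} f v) = ae_class M (\<lambda>\<omega>. \<Sum>\<alpha>\<in>{1..m}. f \<alpha> \<omega> * a \<alpha> \<omega>)"
  using \<open>1 \<le> m\<close> \<open>m \<le> N\<close> \<open>stochastic M {1..m} f\<close>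
proof (induction m arbitrary: f rule: nat_induct_at_least)
  case base
  then have f: "f 1 \<in> borel_measurable M" and f1: "\<And>\<omega>. \<omega> \<in> space M \<Longrightarrow> f 1 \<omega> = 1"
    by (auto simp: stochastic_def)
  have "l0_point M E {1..1} f v = l0_point M E {1..1} (\<lambda>\<alpha> _. if 1 = \<alpha> then 1 else 0) v"
    using f f1 v base.prems by (intro l0_point_cong) auto
  also have "\<dots> = v 1"
    using v base.prems by (intro l0_point_vertex) auto
  finally have "F (l0_point M E {1..1} f v) = ae_class M (a 1)"
    using Fv[of 1] base.prems by simp
  also have "\<dots> = ae_class M (\<lambda>\<omega>. \<Sum>\<alpha>\<in>{1..1}. f \<alpha> \<omega> * a \<alpha> \<omega>)"
    using f f1 a[of 1] base.prems by (subst ae_class_eq_iff) auto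
  finally show ?case .
next
  case (Suc m)
  note f = Suc.prems(2)
  have m: "Suc m \<in> {1..N}" "1 \<in> {1..N}" using Suc.prems(1) by auto
  have f_meas: "f \<alpha> \<in> borel_measurable M" if "\<alpha> \<in> {1..Suc m}" for \<alpha>
    using f that by (simp add: stochastic_def)
  have f_sum: "(\<Sum>\<alpha>\<in>{1..m}. f \<alpha> \<omega>) + f (Suc m) \<omega> = 1" if "\<omega> \<in> space M" for \<omega>
    using f that by (simp add: stochastic_def)
  have f0: "0 \<le> f \<alpha> \<omega>" if "\<alpha> \<in> {1..Suc m}" "\<omega> \<in> space M" for \<alpha> \<omega>
    using f that by (simp add: stochastic_def)
  define \<mu> where "\<mu> \<omega> = (\<Sum>\<alpha>\<in>{1..m}. f \<alpha> \<omega>)" for \<omega>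
  \<comment> \<open>The weights are renormalised after splitting off the last vertex; where \<open>\<mu>\<close> vanishes, any
    weights would do.\<close>
  define g where "g \<alpha> \<omega> = (if \<mu> \<omega> = 0 then if \<alpha> = 1 then 1 else 0 else f \<alpha> \<omega> / \<mu> \<omega>)" for \<alpha> \<omega>
  have \<mu>_meas [measurable]: "\<mu> \<in> borel_measurable M"
    unfolding \<mu>_def using f_meas by (intro borel_measurable_sum) auto
  have \<mu>_0: "0 \<le> \<mu> \<omega>" if "\<omega> \<in> space M" for \<omega>
    unfolding \<mu>_def using f0 that by (intro sum_nonneg) auto
  have \<mu>_1: "\<mu> \<omega> \<le> 1" "1 - \<mu> \<omega> = f (Suc m) \<omega>" if "\<omega> \<in> space M" for \<omega>
    using f_sum[OF that] f0[of "Suc m", OF _ that] by (auto simp: \<mu>_def)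
  \<comment> \<open>Where \<open>\<mu>\<close> vanishes, so do its non-negative summands, and the
    identity survives.\<close>
  have \<mu>g: "\<mu> \<omega> * g \<alpha> \<omega> = f \<alpha> \<omega>" if "\<alpha> \<in> {1..m}" "\<omega> \<in> space M" for \<alpha> \<omega>
  proof (cases "\<mu> \<omega> = 0")
    case True
    then have "f \<alpha> \<omega> = 0"
      using that f0 sum_nonneg_eq_0_iff[of "{1..m}" "\<lambda>\<alpha>. f \<alpha> \<omega>"] by (auto simp: \<mu>_def)
    with True show ?thesis by simp
  qed (simp add: g_def)
  have g: "stochastic M {1..m} g"
    unfolding stochastic_def
  proof (intro conjI ballI)
    show "g \<alpha> \<in> borel_measurable M" if "\<alpha> \<in> {1..m}" for \<alpha>
    proof -
      have [measurable]: "f \<alpha> \<in> borel_measurable M" using f_meas that by simp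
      show ?thesis unfolding g_def by measurable
    qed
    fix \<omega> assume \<omega>: "\<omega> \<in> space M"
    show "0 \<le> g \<alpha> \<omega>" if "\<alpha> \<in> {1..m}" for \<alpha>
      using that f0[OF _ \<omega>] \<mu>_0[OF \<omega>] by (simp add: g_def)
    show "(\<Sum>\<alpha>\<in>{1..m}. g \<alpha> \<omega>) = 1"
    proof (cases "\<mu> \<omega> = 0")
      case True
      then show ?thesis using Suc.hyps by (simp add: g_def)
    next
      case False
      have "(\<Sum>\<alpha>\<in>{1..m}. g \<alpha> \<omega>) = (\<Sum>\<alpha>\<in>{1..m}. f \<alpha> \<omega>) / \<mu> \<omega>"
        using False by (simp add: g_def sum_divide_distrib)
      then show ?thesis using False by (simp add: \<mu>_def)
    qed
  qed
  then have g_meas: "g \<alpha> \<in> borel_measurable M" if "\<alpha> \<in> {1..m}" for \<alpha>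
    using that by (simp add: stochastic_def)
  have v': "v ` {1..k} \<subseteq> carrier E" if "k \<le> N" for k
    using v that by auto
  have vSm: "v (Suc m) \<in> carrier E"
    by (rule subsetD[OF v imageI[OF m(1)]])
  have gP: "l0_point M E {1..m} g v \<in> l0_conv M E (v ` {1..N})"
  proof -
    have "v ` {1..m} \<subseteq> v ` {1..N}" using Suc.prems(1) by (intro image_mono) auto
    then show ?thesis using l0_point_in_conv[OF Suc.hyps g, of v] l0_conv_mono by blast
  qed
  have vS: "v (Suc m) \<in> l0_conv M E (v ` {1..N})"
    using m(1) v by (rule vertex_in_conv)
  have one_minus: "\<one>\<^bsub>L0 M\<^esub> \<ominus>\<^bsub>L0 M\<^esub> ae_class M \<mu> = ae_class M (f (Suc m))"
    using \<mu>_1 f_meas by (simp add: L0_one_minus_class, subst ae_class_eq_iff) auto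
  have "l0_point M E {1..Suc m} f v
     = l0_of_real M (ae_class M (f (Suc m))) \<odot>\<^bsub>E\<^esub> v (Suc m) \<oplus>\<^bsub>E\<^esub> l0_point M E {1..m} f v"
    unfolding l0_point_def atLeastAtMostSuc_conv[OF le_SucI[OF Suc.hyps]]
    using f_meas v'[OF Suc.prems(1)] by (intro M.finsum_insert) (auto simp: image_subset_iff)
  also have "l0_point M E {1..m} f v = l0_point M E {1..m} (\<lambda>\<alpha> \<omega>. \<mu> \<omega> * g \<alpha> \<omega>) v"
    using f_meas g_meas \<mu>g v' Suc.prems(1) by (intro l0_point_cong) auto
  also have "\<dots> = l0_of_real M (ae_class M \<mu>) \<odot>\<^bsub>E\<^esub> l0_point M E {1..m} g v"
    using g_meas v' Suc.prems(1) by (intro l0_point_smult) auto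
  also have "l0_of_real M (ae_class M (f (Suc m))) \<odot>\<^bsub>E\<^esub> v (Suc m) \<oplus>\<^bsub>E\<^esub> \<dots>
      = l0_combination M E (ae_class M \<mu>) (l0_point M E {1..m} g v) (v (Suc m))"
    unfolding l0_combination_def one_minus
    using f_meas vSm g_meas v' Suc.prems(1) by (intro M.a_comm smult_closed l0_point_closed real_class_closed) auto
  finally have "F (l0_point M E {1..Suc m} f v)
      = F (l0_combination M E (ae_class M \<mu>) (l0_point M E {1..m} g v) (v (Suc m)))" by simp
  also have "\<dots> = ae_class M \<mu> \<otimes>\<^bsub>L0 M\<^esub> F (l0_point M E {1..m} g v)
      \<oplus>\<^bsub>L0 M\<^esub> (\<one>\<^bsub>L0 M\<^esub> \<ominus>\<^bsub>L0 M\<^esub> ae_class M \<mu>) \<otimes>\<^bsub>L0 M\<^esub> F (v (Suc m))"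
  proof -
    \<comment> \<open>The definition asks for a representative with values in \<open>[0,1]\<close>
      on all of \<open>space M\<close>; \<open>\<mu>\<close> is one because \<open>f\<close> is
      stochastic everywhere.\<close>
    have "ae_class M \<mu> \<in> L0_unit_interval M"
      unfolding L0_unit_interval_def using \<mu>_meas \<mu>_0 \<mu>_1(1) by auto
    then show ?thesis using F gP vS unfolding l0_affine_on_def by blast
  qed
  also have "\<dots> = ae_class M \<mu> \<otimes>\<^bsub>L0 M\<^esub> ae_class M (\<lambda>\<omega>. \<Sum>\<alpha>\<in>{1..m}. g \<alpha> \<omega> * a \<alpha> \<omega>)
      \<oplus>\<^bsub>L0 M\<^esub> ae_class M (f (Suc m)) \<otimes>\<^bsub>L0 M\<^esub> ae_class M (a (Suc m))"
    using Suc.IH[OF _ g] Suc.prems(1) Fv[OF m(1)] by (simp add: one_minus)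
  also have "\<dots> = ae_class M (\<lambda>\<omega>. \<mu> \<omega> * (\<Sum>\<alpha>\<in>{1..m}. g \<alpha> \<omega> * a \<alpha> \<omega>) + f (Suc m) \<omega> * a (Suc m) \<omega>)"
  proof -
    have sum_meas: "(\<lambda>\<omega>. \<Sum>\<alpha>\<in>{1..m}. g \<alpha> \<omega> * a \<alpha> \<omega>) \<in> borel_measurable M"
      using g_meas a Suc.prems(1) by (intro borel_measurable_sum borel_measurable_times) auto
    show ?thesis
      using sum_meas \<mu>_meas f_meas[of "Suc m"] a[OF m(1)]
      by (simp add: L0_mult_class L0_add_class)
  qed
  also have "\<dots> = ae_class M (\<lambda>\<omega>. \<Sum>\<alpha>\<in>{1..Suc m}. f \<alpha> \<omega> * a \<alpha> \<omega>)"
  proof (subst ae_class_eq_iff)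
    show "(\<lambda>\<omega>. \<mu> \<omega> * (\<Sum>\<alpha>\<in>{1..m}. g \<alpha> \<omega> * a \<alpha> \<omega>) + f (Suc m) \<omega> * a (Suc m) \<omega>) \<in> borel_measurable M"
      using g_meas a Suc.prems(1) f_meas[of "Suc m"] a[OF m(1)]
      by (intro borel_measurable_add borel_measurable_times borel_measurable_sum \<mu>_meas) auto
    show "(\<lambda>\<omega>. \<Sum>\<alpha>\<in>{1..Suc m}. f \<alpha> \<omega> * a \<alpha> \<omega>) \<in> borel_measurable M"
      using f_meas a Suc.prems(1) by (intro borel_measurable_times borel_measurable_sum) auto
    show "AE \<omega> in M. \<mu> \<omega> * (\<Sum>\<alpha>\<in>{1..m}. g \<alpha> \<omega> * a \<alpha> \<omega>) + f (Suc m) \<omega> * a (Suc m) \<omega>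
        = (\<Sum>\<alpha>\<in>{1..Suc m}. f \<alpha> \<omega> * a \<alpha> \<omega>)"
    proof (rule AE_I2)
      fix \<omega> assume "\<omega> \<in> space M"
      then have "\<mu> \<omega> * (\<Sum>\<alpha>\<in>{1..m}. g \<alpha> \<omega> * a \<alpha> \<omega>) = (\<Sum>\<alpha>\<in>{1..m}. f \<alpha> \<omega> * a \<alpha> \<omega>)"
        unfolding sum_distrib_left by (intro sum.cong) (auto simp: \<mu>g mult.assoc[symmetric])
      then show "\<mu> \<omega> * (\<Sum>\<alpha>\<in>{1..m}. g \<alpha> \<omega> * a \<alpha> \<omega>) + f (Suc m) \<omega> * a (Suc m) \<omega>
        = (\<Sum>\<alpha>\<in>{1..Suc m}. f \<alpha> \<omega> * a \<alpha> \<omega>)" by simp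
    qed
  qed
  finally show ?case .
qed

end

section \<open>Payoffs in barycentric coordinates\<close>

text \<open>The players up to \<open>k\<close> randomise according to \<open>x\<close>, the others play the pure strategies \<open>c\<close>.\<close>

primrec mixed_payoff ::
  "(nat \<Rightarrow> 'q set) \<Rightarrow> nat \<Rightarrow> ((nat \<Rightarrow> 'q) \<Rightarrow> real) \<Rightarrow> (nat \<times> 'q \<Rightarrow> real) \<Rightarrow> (nat \<Rightarrow> 'q) \<Rightarrow> real" where
  "mixed_payoff B 0 a x c = a c"
| "mixed_payoff B (Suc k) a x c =
     (\<Sum>\<alpha>\<in>B (Suc k). x (Suc k, \<alpha>) * mixed_payoff B k a x (c(Suc k := \<alpha>)))"

lemma continuous_on_mixed_payoff: "continuous_on S (\<lambda>x. mixed_payoff B k a x c)"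
  by (induction k arbitrary: c)
    (simp_all add: continuous_on_sum continuous_on_mult continuous_on_coordinate)

lemma borel_measurable_mixed_payoff:
  assumes "\<And>c. a c \<in> borel_measurable M" "\<And>k. (\<lambda>\<omega>. x \<omega> k) \<in> borel_measurable M"
  shows "(\<lambda>\<omega>. mixed_payoff B k (\<lambda>c. a c \<omega>) (x \<omega>) c) \<in> borel_measurable M"
  by (induction k arbitrary: c) (auto intro!: assms borel_measurable_sum borel_measurable_times)

text \<open>The recursion up to \<open>k\<close> reads only the rows \<open>1\<close> to
  \<open>k\<close>.\<close>

lemma mixed_payoff_deviate_later:
  "k < i \<Longrightarrow> mixed_payoff B k a (deviate x i y) c = mixed_payoff B k a x c"
  by (induction k arbitrary: c) (simp_all add: deviate_def)

text \<open>Multilinearity in the form that Nash's argument uses: the coefficient of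
  \<open>y \<alpha>\<close> is the payoff after the pure deviation to \<open>\<alpha>\<close>. The
  recursion meets row \<open>i\<close> at level \<open>i\<close> only; above that level an exchange
  of sums is enough.\<close>

lemma mixed_payoff_deviate:
  assumes "finite (B i)" "1 \<le> i" "i \<le> k"
  shows "mixed_payoff B k a (deviate x i y) c
    = (\<Sum>\<alpha>\<in>B i. y \<alpha> * mixed_payoff B k a (deviate x i (pure \<alpha>)) c)"
  using \<open>i \<le> k\<close>
proof (induction k arbitrary: c)
  case 0
  then show ?case using assms(2) by simp
next
  case (Suc k)
  show ?case
  proof (cases "i = Suc k")
    case True
    have "mixed_payoff B (Suc k) a (deviate x i z) c
        = (\<Sum>\<beta>\<in>B i. z \<beta> * mixed_payoff B k a x (c(i := \<beta>)))" for z
      using True by (simp add: mixed_payoff_deviate_later) (simp add: deviate_def)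
    moreover have "(\<Sum>\<beta>\<in>B i. pure \<alpha> \<beta> * mixed_payoff B k a x (c(i := \<beta>))) = mixed_payoff B k a x (c(i := \<alpha>))"
      if "\<alpha> \<in> B i" for \<alpha>
    proof -
      have "(\<Sum>\<beta>\<in>B i. pure \<alpha> \<beta> * mixed_payoff B k a x (c(i := \<beta>)))
          = (\<Sum>\<beta>\<in>B i. if \<beta> = \<alpha> then mixed_payoff B k a x (c(i := \<beta>)) else 0)"
        by (intro sum.cong) (auto simp: pure_def)
      then show ?thesis using that assms(1) by simp
    qed
    ultimately show ?thesis by simp
  next
    case False
    then have i: "i \<le> k" using Suc.prems by simp
    have row: "deviate x i z (Suc k, \<beta>) = x (Suc k, \<beta>)" for z \<beta>
      using False by (simp add: deviate_def)
    have "mixed_payoff B (Suc k) a (deviate x i y) c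
        = (\<Sum>\<beta>\<in>B (Suc k). x (Suc k, \<beta>) *
            (\<Sum>\<alpha>\<in>B i. y \<alpha> * mixed_payoff B k a (deviate x i (pure \<alpha>)) (c(Suc k := \<beta>))))"
      by (simp only: mixed_payoff.simps row Suc.IH[OF i])
    also have "\<dots> = (\<Sum>\<beta>\<in>B (Suc k). \<Sum>\<alpha>\<in>B i. y \<alpha> *
        (x (Suc k, \<beta>) * mixed_payoff B k a (deviate x i (pure \<alpha>)) (c(Suc k := \<beta>))))"
      by (simp add: sum_distrib_left mult.left_commute)
    also have "\<dots> = (\<Sum>\<alpha>\<in>B i. y \<alpha> * mixed_payoff B (Suc k) a (deviate x i (pure \<alpha>)) c)"
      by (subst sum.swap) (simp add: row sum_distrib_left)
    finally show ?thesis .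
  qed
qed

lemma deviate_own: "deviate x i (\<lambda>\<alpha>. x (i, \<alpha>)) = x"
  by (auto simp: deviate_def)

text \<open>The players are switched from pure to mixed strategies one at a time, and each switch
  uses affinity in a single coordinate. The vertex values needed there are the payoffs at
  \<open>c(Suc k := \<alpha>)\<close>, which come from the induction hypothesis; hence the
  generalisation over \<open>c\<close>.\<close>

lemma payoff_eq_mixed_payoff:
  fixes E :: "nat \<Rightarrow> (('a \<Rightarrow> 'k::real_or_complex) set, 'e) module" and N :: "nat \<Rightarrow> nat"
  assumes E: "\<And>i. i \<in> {1..n} \<Longrightarrow> l0_module M (E i)"
    and \<pi>: "\<And>i. i \<in> {1..n} \<Longrightarrow> \<pi> i ` {1..N i} \<subseteq> carrier (E i)"
    and N: "\<And>i. i \<in> {1..n} \<Longrightarrow> 1 \<le> N i"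
    and S: "\<And>i. i \<in> {1..n} \<Longrightarrow> S i = l0_conv M (E i) (\<pi> i ` {1..N i})"
    and F: "multi_l0_affine_on M n E S F"
    and a: "\<And>c. a c \<in> borel_measurable M"
    and Fa: "\<And>c. c \<in> Pi {1..n} (\<lambda>i. {1..N i}) \<Longrightarrow> F (\<lambda>i\<in>{1..n}. \<pi> i (c i)) = ae_class M (a c)"
    and x_meas: "\<And>k. (\<lambda>\<omega>. x \<omega> k) \<in> borel_measurable M"
    and x: "\<And>i. i \<in> {1..n} \<Longrightarrow> stochastic M {1..N i} (\<lambda>\<alpha> \<omega>. x \<omega> (i, \<alpha>))"
    and "c \<in> Pi {1..n} (\<lambda>i. {1..N i})" "k \<le> n"
  shows "F (\<lambda>i\<in>{1..n}. if i \<le> k then l0_point M (E i) {1..N i} (\<lambda>\<alpha> \<omega>. x \<omega> (i, \<alpha>)) (\<pi> i) else \<pi> i (c i))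
    = ae_class M (\<lambda>\<omega>. mixed_payoff (\<lambda>i. {1..N i}) k (\<lambda>c. a c \<omega>) (x \<omega>) c)"
  using \<open>c \<in> _\<close> \<open>k \<le> n\<close>
proof (induction k arbitrary: c)
  case 0
  have "(\<lambda>i\<in>{1..n}. if i \<le> 0 then l0_point M (E i) {1..N i} (\<lambda>\<alpha> \<omega>. x \<omega> (i, \<alpha>)) (\<pi> i) else \<pi> i (c i))
      = (\<lambda>i\<in>{1..n}. \<pi> i (c i))"
    by (intro restrict_ext) auto
  then show ?case by (simp only: mixed_payoff.simps Fa[OF 0(1)])
next
  case (Suc k)
  let ?i = "Suc k"
  let ?pt = "\<lambda>i. l0_point M (E i) {1..N i} (\<lambda>\<alpha> \<omega>. x \<omega> (i, \<alpha>)) (\<pi> i)"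
  define \<sigma> where "\<sigma> c j = (\<lambda>i\<in>{1..n}. if i \<le> j then ?pt i else \<pi> i (c i))" for c j
  have i: "?i \<in> {1..n}" using Suc.prems(2) by simp
  interpret l0_module M "E ?i" by (rule E[OF i])
  have pt: "?pt j \<in> S j" if "j \<in> {1..n}" for j
  proof -
    interpret j: l0_module M "E j" by (rule E[OF that])
    show ?thesis using j.l0_point_in_conv[OF N[OF that] x[OF that], of "\<pi> j"] S[OF that] by simp
  qed
  have vertex: "\<pi> j \<alpha> \<in> S j" if "j \<in> {1..n}" "\<alpha> \<in> {1..N j}" for j \<alpha>
  proof -
    interpret j: l0_module M "E j" by (rule E[OF that(1)])
    show ?thesis using j.vertex_in_conv[OF that(2) \<pi>[OF that(1)]] S[OF that(1)] by simp
  qed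
  have \<sigma>: "\<sigma> c k \<in> (\<Pi>\<^sub>E j\<in>{1..n}. S j)"
    unfolding \<sigma>_def using pt vertex Suc.prems(1) by (auto simp: Pi_iff)
  have aff: "l0_affine_on M (E ?i) (l0_conv M (E ?i) (\<pi> ?i ` {1..N ?i})) (\<lambda>y. F ((\<sigma> c k)(?i := y)))"
    using F i \<sigma> S[OF i] unfolding multi_l0_affine_on_def by metis
  have "F (\<sigma> c (Suc k)) = F ((\<sigma> c k)(?i := ?pt ?i))"
    using i by (intro arg_cong[of _ _ F]) (auto simp: \<sigma>_def)
  also have "\<dots> = ae_class M (\<lambda>\<omega>. \<Sum>\<alpha>\<in>{1..N ?i}. x \<omega> (?i, \<alpha>) *
      mixed_payoff (\<lambda>i. {1..N i}) k (\<lambda>c. a c \<omega>) (x \<omega>) (c(?i := \<alpha>)))"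
  proof (rule l0_affine_point[OF aff \<pi>[OF i]])
    show "F ((\<sigma> c k)(?i := \<pi> ?i \<alpha>))
        = ae_class M (\<lambda>\<omega>. mixed_payoff (\<lambda>i. {1..N i}) k (\<lambda>c. a c \<omega>) (x \<omega>) (c(?i := \<alpha>)))"
      if "\<alpha> \<in> {1..N ?i}" for \<alpha>
    proof -
      \<comment> \<open>Player \<open>Suc k\<close> is still pure in \<open>\<sigma> c k\<close>, so
        inserting a vertex amounts to changing \<open>c\<close>.\<close>
      have "(\<sigma> c k)(?i := \<pi> ?i \<alpha>) = \<sigma> (c(?i := \<alpha>)) k"
        using i by (auto simp: \<sigma>_def)
      moreover have "F (\<sigma> (c(?i := \<alpha>)) k)
          = ae_class M (\<lambda>\<omega>. mixed_payoff (\<lambda>i. {1..N i}) k (\<lambda>c. a c \<omega>) (x \<omega>) (c(?i := \<alpha>)))"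
        unfolding \<sigma>_def using Suc.prems that by (intro Suc.IH) (auto simp: Pi_iff)
      ultimately show ?thesis by simp
    qed
    show "(\<lambda>\<omega>. mixed_payoff (\<lambda>i. {1..N i}) k (\<lambda>c. a c \<omega>) (x \<omega>) (c(?i := \<alpha>))) \<in> borel_measurable M" for \<alpha>
      using a x_meas by (rule borel_measurable_mixed_payoff)
  qed (use N[OF i] x[OF i] in auto)
  finally show ?case by (simp only: \<sigma>_def mixed_payoff.simps)
qed

section \<open>The measurable equilibrium and its deviations\<close>

theorem theorem1p19:
  fixes M :: "'a measure" and n :: nat
    and E :: "nat \<Rightarrow> (('a \<Rightarrow> 'k::real_or_complex) set, 'e) module"
    and rnorm :: "nat \<Rightarrow> 'e \<Rightarrow> ('a \<Rightarrow> real) set"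
    and N :: "nat \<Rightarrow> nat" and \<pi> :: "nat \<Rightarrow> nat \<Rightarrow> 'e"
    and S :: "nat \<Rightarrow> 'e set"
    and p :: "nat \<Rightarrow> (nat \<Rightarrow> 'e) \<Rightarrow> ('a \<Rightarrow> real) set"
  assumes "prob_space M"
    and "\<And>i. i \<in> {1..n} \<Longrightarrow> rn_module M (E i) (rnorm i)"
    and "\<And>i. i \<in> {1..n} \<Longrightarrow> \<pi> i ` {1..N i} \<subseteq> carrier (E i)"
    and "\<And>i. i \<in> {1..n} \<Longrightarrow> l0_affinely_independent M (E i) (N i) (\<pi> i)"
    and "\<And>i. i \<in> {1..n} \<Longrightarrow> S i = l0_conv M (E i) (\<pi> i ` {1..N i})"
    and "\<And>i. i \<in> {1..n} \<Longrightarrow> multi_l0_affine_on M n E S (p i)"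
  shows "\<exists>s \<in> (\<Pi>\<^sub>E i\<in>{1..n}. S i). \<forall>i\<in>{1..n}. \<forall>t\<in>S i. l0_le M (p i (s(i := t))) (p i s)"
proof -
  note \<pi> = assms(3) and S = assms(5) and p = assms(6)
  let ?P = "{1..n}" and ?B = "\<lambda>i. {1..N i}"
  let ?pure = "Pi ?P ?B"
  have E: "l0_module M (E i)" if "i \<in> ?P" for i
    using assms(2)[OF that] unfolding rn_module_def l0_module_def by blast
  have N: "1 \<le> N i" if "i \<in> ?P" for i
    using assms(4)[OF that] by (auto simp: l0_affinely_independent_def)
  have pt: "l0_point M (E i) (?B i) f (\<pi> i) \<in> S i" if "i \<in> ?P" "stochastic M (?B i) f" for i f
  proof -
    interpret l0_module M "E i" by (rule E[OF that(1)])
    show ?thesis using l0_point_in_conv[OF N[OF that(1)] that(2), of "\<pi> i"] S[OF that(1)] by simp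
  qed
  have vertex: "\<pi> i \<alpha> \<in> S i" if "i \<in> ?P" "\<alpha> \<in> ?B i" for i \<alpha>
  proof -
    interpret l0_module M "E i" by (rule E[OF that(1)])
    show ?thesis using vertex_in_conv[OF that(2) \<pi>[OF that(1)]] S[OF that(1)] by simp
  qed
  \<comment> \<open>Outside the pure profiles \<open>0\<close> serves as a default, since
    \<open>payoff_eq_mixed_payoff\<close> asks for measurable representatives at every
    \<open>c\<close>.\<close>
  have rep: "\<exists>a. a \<in> borel_measurable M \<and>
      (c \<in> ?pure \<longrightarrow> p i (\<lambda>j\<in>?P. \<pi> j (c j)) = ae_class M a)" if "i \<in> ?P" for i c
  proof (cases "c \<in> ?pure")
    case True
    then have "(\<lambda>j\<in>?P. \<pi> j (c j)) \<in> (\<Pi>\<^sub>E j\<in>?P. S j)" using vertex by (auto simp: Pi_iff)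
    then have "p i (\<lambda>j\<in>?P. \<pi> j (c j)) \<in> carrier (L0 M)"
      using p[OF that] unfolding multi_l0_affine_on_def by blast
    then show ?thesis by (auto simp: carrier_L0)
  qed (auto intro: exI[of _ "\<lambda>_. 0"])
  have "\<exists>a. \<forall>c. a c \<in> borel_measurable M \<and>
      (c \<in> ?pure \<longrightarrow> p i (\<lambda>j\<in>?P. \<pi> j (c j)) = ae_class M (a c))" if "i \<in> ?P" for i
    by (intro choice allI rep that)
  then have "\<exists>a. \<forall>i\<in>?P. \<forall>c. a i c \<in> borel_measurable M \<and>
      (c \<in> ?pure \<longrightarrow> p i (\<lambda>j\<in>?P. \<pi> j (c j)) = ae_class M (a i c))"
    by (intro bchoice ballI)
  then obtain a where a: "\<And>i c. i \<in> ?P \<Longrightarrow> a i c \<in> borel_measurable M"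
    and pa: "\<And>i c. i \<in> ?P \<Longrightarrow> c \<in> ?pure \<Longrightarrow> p i (\<lambda>j\<in>?P. \<pi> j (c j)) = ae_class M (a i c)"
    by blast
  \<comment> \<open>The profile \<open>\<lambda>_. 1\<close> is a placeholder: at level
    \<open>n\<close> the strategies of all players are overwritten. It is a legal pure profile
    because each player has a vertex \<open>1\<close>.\<close>
  define u where "u \<omega> i x = mixed_payoff ?B n (\<lambda>c. a i c \<omega>) x (\<lambda>_. 1)" for \<omega> i x
  have u_meas: "(\<lambda>\<omega>. u \<omega> i (x \<omega>)) \<in> borel_measurable M"
    if "i \<in> ?P" "\<And>k. (\<lambda>\<omega>. x \<omega> k) \<in> borel_measurable M" for i x
    unfolding u_def using a[OF that(1)] that(2) by (rule borel_measurable_mixed_payoff)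
  have u_cont: "continuous_on K (u \<omega> i)" for K \<omega> i
    unfolding u_def by (rule continuous_on_mixed_payoff)
  have u_lin: "u \<omega> i (deviate x i y) = (\<Sum>\<alpha>\<in>?B i. y \<alpha> * u \<omega> i (deviate x i (pure \<alpha>)))"
    if "i \<in> ?P" for \<omega> i x y
    unfolding u_def using that by (intro mixed_payoff_deviate) auto
  have p_u: "p i (\<lambda>j\<in>?P. l0_point M (E j) (?B j) (\<lambda>\<alpha> \<omega>. x \<omega> (j, \<alpha>)) (\<pi> j)) = ae_class M (\<lambda>\<omega>. u \<omega> i (x \<omega>))"
    if i: "i \<in> ?P" and x_meas: "\<And>k. (\<lambda>\<omega>. x \<omega> k) \<in> borel_measurable M"
      and x: "\<And>j. j \<in> ?P \<Longrightarrow> stochastic M (?B j) (\<lambda>\<alpha> \<omega>. x \<omega> (j, \<alpha>))" for i x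
  proof -
    have "(\<lambda>_. 1) \<in> ?pure" using N by auto
    from payoff_eq_mixed_payoff[OF E \<pi> N S p[OF i] a[OF i] pa[OF i] x_meas x this order_refl]
    have "p i (\<lambda>j\<in>?P. if j \<le> n then l0_point M (E j) (?B j) (\<lambda>\<alpha> \<omega>. x \<omega> (j, \<alpha>)) (\<pi> j) else \<pi> j 1)
        = ae_class M (\<lambda>\<omega>. u \<omega> i (x \<omega>))"
      unfolding u_def by blast
    moreover have "(\<lambda>j\<in>?P. if j \<le> n then l0_point M (E j) (?B j) (\<lambda>\<alpha> \<omega>. x \<omega> (j, \<alpha>)) (\<pi> j) else \<pi> j 1)
        = (\<lambda>j\<in>?P. l0_point M (E j) (?B j) (\<lambda>\<alpha> \<omega>. x \<omega> (j, \<alpha>)) (\<pi> j))"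
      by (intro restrict_ext) auto
    ultimately show ?thesis by simp
  qed
  define regret where
    "regret \<omega> x = (\<Sum>i\<in>?P. \<Sum>\<alpha>\<in>?B i. max 0 (u \<omega> i (deviate x i (pure \<alpha>)) - u \<omega> i x))" for \<omega> x
  have regret_0: "regret \<omega> x = 0 \<longleftrightarrow> (\<forall>i\<in>?P. \<forall>\<alpha>\<in>?B i. u \<omega> i (deviate x i (pure \<alpha>)) \<le> u \<omega> i x)" for \<omega> x
  proof -
    have "max 0 (b - d) = 0 \<longleftrightarrow> b \<le> d" for b d :: real by auto
    then show ?thesis unfolding regret_def by (simp add: sum_nonneg_eq_0_iff sum_nonneg)
  qed
  have "\<exists>x. (\<forall>k. (\<lambda>\<omega>. x \<omega> k) \<in> borel_measurable M) \<and>
      (\<forall>\<omega>\<in>space M. x \<omega> \<in> mixed_profiles ?P ?B \<and> regret \<omega> (x \<omega>) = 0)"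
  proof (rule measurable_zero_selection)
    show "compact (mixed_profiles ?P ?B)" by (intro compact_mixed_profiles) simp
    show "(\<lambda>\<omega>. regret \<omega> y) \<in> borel_measurable M" for y
      unfolding regret_def
      by (intro borel_measurable_sum borel_measurable_max borel_measurable_diff u_meas) auto
    show "continuous_on (mixed_profiles ?P ?B) (regret \<omega>)" for \<omega>
      unfolding regret_def
      by (intro continuous_on_sum continuous_on_max continuous_on_diff continuous_on_const u_cont
          continuous_on_compose2[OF u_cont continuous_on_deviate]) auto
    show "\<exists>y\<in>mixed_profiles ?P ?B. regret \<omega> y = 0" for \<omega>
    proof -
      \<comment> \<open>Deviating to one's own row changes nothing, which turns multilinearity into
        the averaging hypothesis of \<open>finite_nash\<close>.\<close>
      have "u \<omega> i y = (\<Sum>\<alpha>\<in>?B i. y (i, \<alpha>) * u \<omega> i (deviate y i (pure \<alpha>)))" if "i \<in> ?P" for i y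
        using u_lin[OF that, of \<omega> y "\<lambda>\<alpha>. y (i, \<alpha>)"] by (simp add: deviate_own)
      then have "\<exists>y\<in>mixed_profiles ?P ?B. \<forall>i\<in>?P. \<forall>\<alpha>\<in>?B i. u \<omega> i (deviate y i (pure \<alpha>)) \<le> u \<omega> i y"
        using N by (intro finite_nash u_cont) auto
      then show ?thesis by (simp only: regret_0)
    qed
    show "finite (Sigma ?P ?B)" by simp
    show "y k = 0" if "y \<in> mixed_profiles ?P ?B" "k \<notin> Sigma ?P ?B" for y k
      using that unfolding mixed_profiles_def by blast
  qed
  then obtain x where x_meas: "\<And>k. (\<lambda>\<omega>. x \<omega> k) \<in> borel_measurable M"
    and x: "\<And>\<omega>. \<omega> \<in> space M \<Longrightarrow> x \<omega> \<in> mixed_profiles ?P ?B"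
    and x_regret: "\<And>\<omega>. \<omega> \<in> space M \<Longrightarrow> regret \<omega> (x \<omega>) = 0"
    by blast
  have x_stoch: "stochastic M (?B i) (\<lambda>\<alpha> \<omega>. x \<omega> (i, \<alpha>))" if "i \<in> ?P" for i
    using x x_meas that by (auto simp: stochastic_def mixed_profiles_def)
  define s where "s = (\<lambda>i\<in>?P. l0_point M (E i) (?B i) (\<lambda>\<alpha> \<omega>. x \<omega> (i, \<alpha>)) (\<pi> i))"
  have p_s: "p i s = ae_class M (\<lambda>\<omega>. u \<omega> i (x \<omega>))" if "i \<in> ?P" for i
    unfolding s_def using that x_meas x_stoch by (rule p_u)
  have "l0_le M (p i (s(i := t))) (p i s)" if i: "i \<in> ?P" and t: "t \<in> S i" for i t
  proof -
    interpret l0_module M "E i" by (rule E[OF i])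
    obtain f where f: "stochastic M (?B i) f" "t = l0_point M (E i) (?B i) f (\<pi> i)"
      using l0_conv_point[OF N[OF i] \<pi>[OF i]] t S[OF i] by blast
    \<comment> \<open>The weights \<open>f\<close> are known to be measurable only on the vertices
      of player \<open>i\<close>; extension by \<open>0\<close> makes every coordinate of
      \<open>y\<close> measurable, as \<open>p_u\<close> requires.\<close>
    define g where "g \<alpha> = (if \<alpha> \<in> ?B i then f \<alpha> else (\<lambda>_. 0))" for \<alpha>
    have g_stoch: "stochastic M (?B i) g" and g_meas: "g \<alpha> \<in> borel_measurable M" for \<alpha>
      using f(1) by (auto simp: stochastic_def g_def)
    have t_g: "t = l0_point M (E i) (?B i) g (\<pi> i)"
      unfolding f(2) using f(1) g_meas \<pi>[OF i] by (intro l0_point_cong) (auto simp: g_def stochastic_def)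
    define y where "y \<omega> = deviate (x \<omega>) i (\<lambda>\<alpha>. g \<alpha> \<omega>)" for \<omega>
    have y_meas: "(\<lambda>\<omega>. y \<omega> k) \<in> borel_measurable M" for k
      using x_meas g_meas by (cases k; cases "fst k = i") (simp_all add: y_def deviate_def)
    have y_i: "(\<lambda>\<alpha> \<omega>. y \<omega> (i, \<alpha>)) = g" and y_j: "j \<noteq> i \<Longrightarrow> y \<omega> (j, \<alpha>) = x \<omega> (j, \<alpha>)" for \<omega> j \<alpha>
      by (simp_all add: y_def deviate_def)
    have y_stoch: "stochastic M (?B j) (\<lambda>\<alpha> \<omega>. y \<omega> (j, \<alpha>))" if "j \<in> ?P" for j
      using x_stoch[OF that] g_stoch y_i y_j by (cases "j = i") simp_all
    have "s(i := t) = (\<lambda>j\<in>?P. l0_point M (E j) (?B j) (\<lambda>\<alpha> \<omega>. y \<omega> (j, \<alpha>)) (\<pi> j))"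
      using i y_i y_j by (auto simp: s_def t_g fun_eq_iff)
    then have p_y: "p i (s(i := t)) = ae_class M (\<lambda>\<omega>. u \<omega> i (y \<omega>))"
      using p_u[OF i y_meas y_stoch] by simp
    have "u \<omega> i (y \<omega>) \<le> u \<omega> i (x \<omega>)" if \<omega>: "\<omega> \<in> space M" for \<omega>
    proof -
      \<comment> \<open>The payoff of a mixed deviation is an average of payoffs of pure ones, and
        zero regret bounds each of these.\<close>
      have "u \<omega> i (y \<omega>) = (\<Sum>\<alpha>\<in>?B i. g \<alpha> \<omega> * u \<omega> i (deviate (x \<omega>) i (pure \<alpha>)))"
        unfolding y_def by (rule u_lin[OF i])
      also have "\<dots> \<le> (\<Sum>\<alpha>\<in>?B i. g \<alpha> \<omega> * u \<omega> i (x \<omega>))"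
        using x_regret[OF \<omega>] i g_stoch \<omega>
        by (intro sum_mono mult_left_mono) (auto simp: regret_0 stochastic_def)
      also have "\<dots> = u \<omega> i (x \<omega>)"
        using g_stoch \<omega> by (simp add: stochastic_def sum_distrib_right[symmetric])
      finally show ?thesis .
    qed
    then show ?thesis
      unfolding p_y p_s[OF i] using u_meas[OF i] x_meas y_meas by (subst l0_le_class_iff) auto
  qed
  moreover have "s \<in> (\<Pi>\<^sub>E i\<in>?P. S i)"
    unfolding s_def using pt x_stoch by auto
  ultimately show ?thesis by blast
qed

end
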